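(* Let $\mathcal{A}$ be a fixed finite alphabet. For every nonempty pattern $w\in\mathcal{A}^{\star}$, the position lattice of $w$ (i.e. all values $S_s(i,x)$ and $T_s(i,x)$ for $s\in\mathcal{L}$, $i\in\{0,\dots,|w|-1\}\setminus s$, $x\in\mathcal{A}$) can be computed in $O(|w|\,2^{|w|})$ time using $O(|w|\,2^{|w|})$ memory.
   Context: Words are indexed from $0$. For $I\subseteq\mathbb{N}$ and $k\in\mathbb{N}$, $I\ominus k=\{i-k: i\in I,\ i\ge k\}$. The position lattice of $w$ consists of: the set $\mathcal{L}$ of all subsets of $\{0,\dots,|w|-1\}$ other than $\{0,\dots,|w|-1\}$ itself; and, for each $s\in\mathcal{L}$, maps $S_s,T_s$ defined on $(\{0,\dots,|w|-1\}\setminus s)\times\mathcal{A}$ by: $S_s(i,x)$ is the least integer $k$, with $k\ge1$ if $|s|=|w|-1$ and $k\ge0$ otherwise, such that ($w_{i-k}=x$ whenever $i\ge k$) and $w_j=w_{j+k}$ for all $j\in s\ominus k$; and $T_s(i,x)=(s\cup\{i\})\ominus S_s(i,x)$. *)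

theory Defs
  imports
    Complex_Main
    "HOL-Library.Landau_Symbols"
    "HOL-Library.Nat_Bijection"
begin

section \<open>The position lattice of a pattern\<close>

definition ominus :: "nat set \<Rightarrow> nat \<Rightarrow> nat set" (infixl "\<ominus>" 65) where
  "I \<ominus> k = {i - k | i. i \<in> I \<and> i \<ge> k}"

definition lattice_states :: "'a list \<Rightarrow> nat set set" where
  "lattice_states w = Pow {0..<length w} - {{0..<length w}}"

definition admissible_shift :: "'a list \<Rightarrow> nat set \<Rightarrow> nat \<Rightarrow> 'a \<Rightarrow> nat \<Rightarrow> bool" where
  "admissible_shift w s i x k \<longleftrightarrow>
     (if card s = length w - 1 then k \<ge> 1 else k \<ge> 0) \<and>
     (i \<ge> k \<longrightarrow> w ! (i - k) = x) \<and>
     (\<forall>j \<in> s \<ominus> k. w ! j = w ! (j + k))"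

definition lattice_shift :: "'a list \<Rightarrow> nat set \<Rightarrow> nat \<Rightarrow> 'a \<Rightarrow> nat" where
  "lattice_shift w s i x = (LEAST k. admissible_shift w s i x k)"

definition lattice_next :: "'a list \<Rightarrow> nat set \<Rightarrow> nat \<Rightarrow> 'a \<Rightarrow> nat set" where
  "lattice_next w s i x = (s \<union> {i}) \<ominus> lattice_shift w s i x"

text \<open>The minimum in \<^const>\<open>lattice_shift\<close> is attained: shifting by the whole pattern is
  always admissible.\<close>

lemma admissible_shift_length:
  assumes "w \<noteq> []" "s \<in> lattice_states w" "i < length w"
  shows "admissible_shift w s i x (length w)"
proof -
  have "s \<ominus> length w = {}"
    using assms(2) by (auto simp: ominus_def lattice_states_def subset_iff)
  then show ?thesis
    using assms(1,3) by (auto simp: admissible_shift_def Suc_le_eq)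
qed

lemma admissible_lattice_shift:
  assumes "w \<noteq> []" "s \<in> lattice_states w" "i < length w"
  shows "admissible_shift w s i x (lattice_shift w s i x)"
  unfolding lattice_shift_def using admissible_shift_length[OF assms] by (rule LeastI)


section \<open>Unit-cost random access machine\<close>

text \<open>
  A word RAM with \<open>m\<close> memory cells and words of \<open>b\<close> bits. A program is a fixed piece of
  structured code over registers (a given program mentions finitely many) with indirect
  access to memory. Each primitive instruction and each test costs one time unit. An
  instruction whose result does not fit into a word, or that accesses an address outside
  \<open>{0..<m}\<close>, has no execution, so an execution certifies both resource bounds.
  Subtraction is truncated at 0.
\<close>

type_synonym reg = nat

type_synonym state = "(reg \<Rightarrow> nat) \<times> (nat \<Rightarrow> nat)"

datatype arith = Add | Sub | Mul | Div | Mod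

fun arith_val :: "arith \<Rightarrow> nat \<Rightarrow> nat \<Rightarrow> nat" where
  "arith_val Add u v = u + v"
| "arith_val Sub u v = u - v"
| "arith_val Mul u v = u * v"
| "arith_val Div u v = u div v"
| "arith_val Mod u v = u mod v"

datatype com =
    Skip
  | Const reg nat
  | Arith arith reg reg reg
  | Load reg reg
  | Store reg reg
  | Seq com com
  | IfLess reg reg com com
  | WhileLess reg reg com

text \<open>\<open>exec b m c \<sigma> t \<sigma>'\<close>: started in \<open>\<sigma>\<close>, the code \<open>c\<close> halts in \<open>\<sigma>'\<close> after \<open>t\<close> time units.\<close>

inductive exec :: "nat \<Rightarrow> nat \<Rightarrow> com \<Rightarrow> state \<Rightarrow> nat \<Rightarrow> state \<Rightarrow> bool" for b m :: nat where
  Skip: "exec b m Skip (R, M) 1 (R, M)"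
| Const: "v < 2 ^ b \<Longrightarrow> exec b m (Const r v) (R, M) 1 (R(r := v), M)"
| Arith: "arith_val f (R p) (R q) < 2 ^ b \<Longrightarrow>
    exec b m (Arith f r p q) (R, M) 1 (R(r := arith_val f (R p) (R q)), M)"
| Load: "R p < m \<Longrightarrow> exec b m (Load r p) (R, M) 1 (R(r := M (R p)), M)"
| Store: "R p < m \<Longrightarrow> exec b m (Store p q) (R, M) 1 (R, M(R p := R q))"
| Seq: "exec b m c1 \<sigma> t1 \<sigma>' \<Longrightarrow> exec b m c2 \<sigma>' t2 \<sigma>'' \<Longrightarrow>
    exec b m (Seq c1 c2) \<sigma> (t1 + t2) \<sigma>''"
| IfTrue: "R p < R q \<Longrightarrow> exec b m c1 (R, M) t \<sigma>' \<Longrightarrow>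
    exec b m (IfLess p q c1 c2) (R, M) (1 + t) \<sigma>'"
| IfFalse: "\<not> R p < R q \<Longrightarrow> exec b m c2 (R, M) t \<sigma>' \<Longrightarrow>
    exec b m (IfLess p q c1 c2) (R, M) (1 + t) \<sigma>'"
| WhileFalse: "\<not> R p < R q \<Longrightarrow> exec b m (WhileLess p q c) (R, M) 1 (R, M)"
| WhileTrue: "R p < R q \<Longrightarrow> exec b m c (R, M) t1 \<sigma>' \<Longrightarrow>
    exec b m (WhileLess p q c) \<sigma>' t2 \<sigma>'' \<Longrightarrow>
    exec b m (WhileLess p q c) (R, M) (1 + t1 + t2) \<sigma>''"

definition ram_state :: "nat \<Rightarrow> nat \<Rightarrow> state \<Rightarrow> bool" where
  "ram_state b m \<sigma> \<longleftrightarrow>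
     (\<forall>r. fst \<sigma> r < 2 ^ b) \<and> (\<forall>a. snd \<sigma> a < 2 ^ b) \<and> (\<forall>a\<ge>m. snd \<sigma> a = 0)"

lemma exec_ram_state: "exec b m c \<sigma> t \<sigma>' \<Longrightarrow> ram_state b m \<sigma> \<Longrightarrow> ram_state b m \<sigma>'"
  by (induction rule: exec.induct) (auto simp: ram_state_def)

lemma exec_deterministic:
  "exec b m c \<sigma> t \<sigma>' \<Longrightarrow> exec b m c \<sigma> t' \<sigma>'' \<Longrightarrow> t' = t \<and> \<sigma>'' = \<sigma>'"
proof (induction arbitrary: t' \<sigma>'' rule: exec.induct)
  case (Seq c1 \<sigma> t1 \<sigma>1 c2 t2 \<sigma>2)
  from Seq.prems Seq.IH show ?case by cases blast
next
  case (WhileTrue R p q c M t1 \<sigma>1 t2 \<sigma>2)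
  from WhileTrue.prems WhileTrue.IH WhileTrue.hyps show ?case by cases blast+
qed (erule exec.cases; auto)+


section \<open>Input and output conventions\<close>

text \<open>Letters are numbered by \<open>enc\<close>. Register 0 holds the length of the pattern, the
  pattern occupies the first memory cells, everything else is 0.\<close>

definition input_state :: "('a \<Rightarrow> nat) \<Rightarrow> 'a list \<Rightarrow> state" where
  "input_state enc w =
     ((\<lambda>r. if r = 0 then length w else 0),
      (\<lambda>a. if a < length w then enc (w ! a) else 0))"

text \<open>Registers 0 and 1 point to two row-major tables indexed by \<open>(s, i, x)\<close>, holding the
  shifts and the successor states. A set of positions is represented by its bit mask
  \<^const>\<open>set_encode\<close>, which fits into a single word.\<close>

definition table_index :: "'a set \<Rightarrow> ('a \<Rightarrow> nat) \<Rightarrow> 'a list \<Rightarrow> nat set \<Rightarrow> nat \<Rightarrow> 'a \<Rightarrow> nat" where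
  "table_index A enc w s i x = (set_encode s * length w + i) * card A + enc x"

definition stores_position_lattice ::
    "'a set \<Rightarrow> ('a \<Rightarrow> nat) \<Rightarrow> 'a list \<Rightarrow> nat \<Rightarrow> state \<Rightarrow> bool" where
  "stores_position_lattice A enc w m \<sigma> \<longleftrightarrow>
     (\<forall>s \<in> lattice_states w. \<forall>i \<in> {0..<length w} - s. \<forall>x \<in> A.
        let a = fst \<sigma> 0 + table_index A enc w s i x;
            a' = fst \<sigma> 1 + table_index A enc w s i x
        in a < m \<and> snd \<sigma> a = lattice_shift w s i x \<and>
           a' < m \<and> snd \<sigma> a' = set_encode (lattice_next w s i x))"

end

theory Submission
  imports Defs
begin

text \<open>
  The tables are filled in increasing order of the bit mask of \<open>u = s \<union> {i}\<close>. What is known about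
  the text is a partial map \<open>f\<close> from positions to letters; if \<open>k\<close> is the least shift agreeing with
  \<open>f\<close>, then the least shift agreeing with one more letter \<open>c\<close> at \<open>j \<ge> k\<close> is
  \<open>k + S\<^sub>T(j - k, c)\<close> for \<open>T = dom f \<ominus> k\<close>, and both it and the new set of known positions are
  found by one table lookup at a set obtained from \<open>dom f \<union> {j}\<close> by shifting by \<open>k\<close>.
  Hence the entry \<open>(s, i, x)\<close> takes constant time. If \<open>x\<close> is the letter \<open>w\<^sub>i\<close> and \<open>u\<close> is not full,
  the shift is 0. If \<open>x \<noteq> w\<^sub>i\<close>, choose \<open>g \<in> s\<close>, start with the letters of \<open>w\<close> on \<open>s - {g}\<close>,
  and read first \<open>x\<close> at \<open>i\<close>, which forces a positive shift, and then \<open>w\<^sub>g\<close> at \<open>g\<close>; both lookups are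
  at sets with a smaller mask. If \<open>s\<close> is empty, start with shift 1 and read \<open>x\<close> at \<open>i\<close>. Finally,
  for full \<open>u\<close> and \<open>x = w\<^sub>i\<close> the answer is the least period of \<open>w\<close>, found by starting with shift 1
  and reading all letters of \<open>w\<close> in turn.
\<close>

section \<open>Shifts consistent with partial knowledge of the text\<close>

definition agrees :: "'a list \<Rightarrow> (nat \<rightharpoonup> 'a) \<Rightarrow> nat \<Rightarrow> bool" where
  "agrees w f k \<longleftrightarrow> (\<forall>j c. f j = Some c \<longrightarrow> k \<le> j \<longrightarrow> w ! (j - k) = c)"

text \<open>The intended starts \<open>k0\<close> are 0 and 1. Start 1 expresses the ban on shift 0
  when all positions are known, and also serves as a head start in computations.\<close>

definition first_fit :: "'a list \<Rightarrow> (nat \<rightharpoonup> 'a) \<Rightarrow> nat \<Rightarrow> nat \<Rightarrow> bool" where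
  "first_fit w f k0 k \<longleftrightarrow>
     k0 \<le> k \<and> agrees w f k \<and> (\<forall>k'. k0 \<le> k' \<longrightarrow> agrees w f k' \<longrightarrow> k \<le> k')"

definition letters_at :: "'a list \<Rightarrow> nat set \<Rightarrow> nat \<rightharpoonup> 'a" where
  "letters_at w s j = (if j \<in> s then Some (w ! j) else None)"

lemma dom_letters_at [simp]: "dom (letters_at w s) = s"
  by (auto simp: letters_at_def dom_def)

lemma letters_at_insert: "letters_at w (insert j s) = (letters_at w s)(j \<mapsto> w ! j)"
  by (auto simp: letters_at_def)

lemma letters_at_empty [simp]: "letters_at w {} = Map.empty"
  by (auto simp: letters_at_def)

lemma mem_ominus: "j \<in> s \<ominus> k \<longleftrightarrow> j + k \<in> s"
  by (auto simp: ominus_def) force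

lemma ominus_0 [simp]: "s \<ominus> 0 = s"
  by (auto simp: mem_ominus)

lemma ominus_insert:
  "insert j s \<ominus> k = (if k \<le> j then insert (j - k) (s \<ominus> k) else s \<ominus> k)"
  by (auto simp: mem_ominus)

lemma ominus_subset: "s \<subseteq> {..<n} \<Longrightarrow> s \<ominus> k \<subseteq> {..<n}"
  by (fastforce simp: mem_ominus)

text \<open>The condition on the new letter and the one on the overlap of \<open>w\<close> with
  itself merge into agreement with one partial map. Since \<open>i\<close> is outside
  \<open>s\<close>, the update overwrites no letter.\<close>

lemma admissible_shift_iff:
  assumes "i \<notin> s"
  shows "admissible_shift w s i x k \<longleftrightarrow>
    (if card s = length w - 1 then 1 else 0) \<le> k \<and> agrees w ((letters_at w s)(i \<mapsto> x)) k"
proof -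
  have "(\<forall>j \<in> s \<ominus> k. w ! j = w ! (j + k)) \<longleftrightarrow> (\<forall>j\<in>s. k \<le> j \<longrightarrow> w ! (j - k) = w ! j)"
    unfolding ominus_def by force
  then show ?thesis
    using assms by (auto simp: admissible_shift_def agrees_def letters_at_def)
qed

lemma lattice_shift_eqI:
  assumes "i \<notin> s"
    and "first_fit w ((letters_at w s)(i \<mapsto> x)) (if card s = length w - 1 then 1 else 0) k"
  shows "lattice_shift w s i x = k"
  unfolding lattice_shift_def using assms
  by (intro Least_equality) (auto simp: admissible_shift_iff first_fit_def)

lemma agrees_length:
  assumes "dom f \<subseteq> {..<length w}"
  shows "agrees w f (length w)"
  using assms by (force simp: agrees_def dom_def)

lemma first_fit_le_length:
  assumes "first_fit w f k0 k" "dom f \<subseteq> {..<length w}" "k0 \<le> length w"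
  shows "k \<le> length w"
  using assms agrees_length[of f w] by (auto simp: first_fit_def)

lemma first_fit_lattice_shift:
  assumes "i \<notin> s" "s \<subseteq> {..<length w}" "i < length w"
  shows "first_fit w ((letters_at w s)(i \<mapsto> x)) (if card s = length w - 1 then 1 else 0)
           (lattice_shift w s i x)"
proof -
  have ne: "w \<noteq> []" and st: "s \<in> lattice_states w"
    using assms by (auto simp: lattice_states_def lessThan_atLeast0)
  have "admissible_shift w s i x (lattice_shift w s i x)"
    by (rule admissible_lattice_shift[OF ne st assms(3)])
  moreover have "lattice_shift w s i x \<le> k'" if "admissible_shift w s i x k'" for k'
    unfolding lattice_shift_def using that by (rule Least_le)
  ultimately show ?thesis
    using assms(1) by (simp add: admissible_shift_iff first_fit_def)
qed

text \<open>Once the pattern, shifted by \<open>k\<close>, agrees with \<open>f\<close>, the known letters seen from the shifted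
  pattern are the letters of the pattern itself.\<close>

lemma agrees_upd_add:
  assumes "agrees w f k" "j \<notin> dom f" "k \<le> j"
  shows "agrees w (f(j \<mapsto> c)) (k + e) \<longleftrightarrow>
         agrees w ((letters_at w (dom f \<ominus> k))(j - k \<mapsto> c)) e" (is "?L \<longleftrightarrow> ?R")
proof
  assume L: ?L
  show ?R unfolding agrees_def
  proof (intro allI impI)
    fix j' c' assume *: "((letters_at w (dom f \<ominus> k))(j - k \<mapsto> c)) j' = Some c'" "e \<le> j'"
    show "w ! (j' - e) = c'"
    proof (cases "j' = j - k")
      case True
      with * L assms show ?thesis
        by (auto simp: agrees_def dest!: spec[of _ j])
    next
      case False
      with * obtain d where d: "f (j' + k) = Some d" "c' = w ! j'"
        by (auto simp: letters_at_def mem_ominus split: if_splits)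
      then have "w ! j' = d" using assms(1) by (auto simp: agrees_def dest!: spec[of _ "j' + k"])
      moreover have "j' + k \<noteq> j" using False by auto
      with d * L have "w ! (j' - e) = d"
        by (auto simp: agrees_def dest!: spec[of _ "j' + k"])
      ultimately show ?thesis using d by simp
    qed
  qed
next
  assume R: ?R
  show ?L unfolding agrees_def
  proof (intro allI impI)
    fix j' c' assume *: "(f(j \<mapsto> c)) j' = Some c'" "k + e \<le> j'"
    show "w ! (j' - (k + e)) = c'"
    proof (cases "j' = j")
      case True
      with * R show ?thesis
        by (auto simp: agrees_def dest!: spec[of _ "j - k"])
    next
      case False
      with * have f: "f j' = Some c'" by auto
      then have "w ! (j' - k) = c'" using assms(1) * by (auto simp: agrees_def)
      moreover have "j' - k \<noteq> j - k" "j' - k \<in> dom f \<ominus> k"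
        using False f * assms(3) by (auto simp: mem_ominus)
      ultimately show ?thesis
        using R * by (auto simp: agrees_def letters_at_def dest!: spec[of _ "j' - k"])
    qed
  qed
qed

text \<open>The recurrence behind every table lookup. The new least shift is \<open>k + e\<close>
  for some \<open>e\<close>, and by \<open>agrees_upd_add\<close> the least such \<open>e\<close> is
  a lattice shift. The hypothesis \<open>card\<close> ensures that this table entry minimises from 0
  and not from 1.\<close>

lemma first_fit_step:
  assumes dom: "dom f \<subseteq> {..<length w}" and fit: "first_fit w f k0 k"
    and j: "j < length w" "j \<notin> dom f" "k \<le> j"
    and card: "card (dom f \<ominus> k) \<noteq> length w - 1"
  shows "first_fit w (f(j \<mapsto> c)) k0 (k + lattice_shift w (dom f \<ominus> k) (j - k) c)"
    and "insert j (dom f) \<ominus> (k + lattice_shift w (dom f \<ominus> k) (j - k) c)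
         = lattice_next w (dom f \<ominus> k) (j - k) c"
proof -
  let ?d = "lattice_shift w (dom f \<ominus> k) (j - k) c"
  have ag: "agrees w f k" using fit by (simp add: first_fit_def)
  note iff = agrees_upd_add[OF ag j(2,3), of c]
  have "j - k \<notin> dom f \<ominus> k" using j by (simp add: mem_ominus)
  then have d: "first_fit w ((letters_at w (dom f \<ominus> k))(j - k \<mapsto> c)) 0 ?d"
    using first_fit_lattice_shift[of "j - k" "dom f \<ominus> k" w c] ominus_subset[OF dom] j card
    by auto
  show "first_fit w (f(j \<mapsto> c)) k0 (k + ?d)"
    unfolding first_fit_def
  proof (intro conjI allI impI)
    show "k0 \<le> k + ?d" using fit by (auto simp: first_fit_def)
    show "agrees w (f(j \<mapsto> c)) (k + ?d)" using d by (auto simp: iff first_fit_def)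
    fix k' assume k': "k0 \<le> k'" "agrees w (f(j \<mapsto> c)) k'"
    \<comment> \<open>More knowledge leaves fewer fitting shifts, so no candidate lies below
      \<open>k\<close>.\<close>
    then have "agrees w f k'" using j(2) unfolding agrees_def
      by (metis domIff fun_upd_other option.distinct(1))
    then have "k \<le> k'" using fit k' by (auto simp: first_fit_def)
    then obtain e where e: "k' = k + e" using le_Suc_ex by blast
    with k' iff d show "k + ?d \<le> k'" by (auto simp: first_fit_def)
  qed
  \<comment> \<open>Shifting by \<open>k\<close> and then by \<open>?d\<close> is shifting by the
    sum, so the successor table yields the new known positions.\<close>
  show "insert j (dom f) \<ominus> (k + ?d) = lattice_next w (dom f \<ominus> k) (j - k) c"
  proof -
    have "x + (k + ?d) = j \<longleftrightarrow> x + ?d = j - k" for x using j(3) by auto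
    then show ?thesis by (auto simp: lattice_next_def mem_ominus add_ac)
  qed
qed

text \<open>A position \<open>j < k\<close> has already fallen off the left end, so its letter
  changes neither the shift nor the visible known positions.\<close>

lemma first_fit_skip:
  assumes "first_fit w f k0 k" "j \<notin> dom f" "j < k"
  shows "first_fit w (f(j \<mapsto> c)) k0 k" "insert j (dom f) \<ominus> k = dom f \<ominus> k"
proof -
  have "agrees w f k'" if "agrees w (f(j \<mapsto> c)) k'" for k'
    using that assms(2) unfolding agrees_def by (metis domIff fun_upd_other option.distinct(1))
  moreover have "agrees w (f(j \<mapsto> c)) k"
    using assms by (simp add: first_fit_def agrees_def)
  ultimately show "first_fit w (f(j \<mapsto> c)) k0 k"
    using assms(1) by (simp add: first_fit_def)
  show "insert j (dom f) \<ominus> k = dom f \<ominus> k"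
    using assms(3) by (simp add: ominus_insert)
qed

text \<open>Lets a computation start at 0 or at 1, whichever is convenient, even if the table entry
  prescribes the other start.\<close>

lemma first_fit_change_start:
  assumes "first_fit w f k0 k" "k1 \<le> k" "\<And>k'. k1 \<le> k' \<Longrightarrow> k' < k0 \<Longrightarrow> \<not> agrees w f k'"
  shows "first_fit w f k1 k"
  using assms by (auto simp: first_fit_def) (metis not_less)

lemma not_agrees_0: "f i = Some x \<Longrightarrow> w ! i \<noteq> x \<Longrightarrow> \<not> agrees w f 0"
  by (auto simp: agrees_def)

lemma agrees_letters_at_0 [simp]: "agrees w (letters_at w s) 0"
  by (auto simp: agrees_def letters_at_def split: if_splits)

text \<open>Reading \<open>w ! i\<close> only extends the known part of \<open>w\<close> itself, and
  \<open>w\<close> fits itself at offset 0.\<close>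

lemma lattice_shift_0:
  assumes "i \<notin> s" "card s \<noteq> length w - 1"
  shows "lattice_shift w s i (w ! i) = 0"
  using assms
  by (intro lattice_shift_eqI) (simp_all add: first_fit_def flip: letters_at_insert)

text \<open>The machine sees numbers instead of letters. Admissibility only compares letters for
  equality, which an injective numbering preserves.\<close>

lemma lattice_shift_map:
  assumes "inj_on g A" "w \<in> lists A" "x \<in> A" "s \<subseteq> {..<length w}" "i < length w"
  shows "lattice_shift (map g w) s i (g x) = lattice_shift w s i x"
proof -
  have w: "w ! j \<in> A" if "j < length w" for j using assms(2) that by auto
  have "admissible_shift (map g w) s i (g x) k = admissible_shift w s i x k" for k
  proof -
    have "g (w ! (i - k)) = g x \<longleftrightarrow> w ! (i - k) = x"
      using w assms by (intro inj_on_eq_iff[OF assms(1)]) auto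
    moreover have "map g w ! j = map g w ! (j + k) \<longleftrightarrow> w ! j = w ! (j + k)" if "j \<in> s \<ominus> k" for j
    proof -
      have "j + k < length w" using that assms(4) by (auto simp: mem_ominus)
      then show ?thesis using w inj_on_eq_iff[OF assms(1), of "w ! j" "w ! (j + k)"] by auto
    qed
    ultimately show ?thesis
      using assms(5) by (auto simp: admissible_shift_def)
  qed
  then show ?thesis by (simp add: lattice_shift_def)
qed


section \<open>Bit masks\<close>

lemma set_encode_strict_mono: "A \<subset> B \<Longrightarrow> finite B \<Longrightarrow> set_encode A < set_encode B"
  unfolding set_encode_def by (elim psubsetE, blast intro: sum_strict_mono2 zero_less_power pos2)

lemma set_encode_mono: "A \<subseteq> B \<Longrightarrow> finite B \<Longrightarrow> set_encode A \<le> set_encode B"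
  unfolding set_encode_def by (rule sum_mono2) auto

lemma set_encode_lessThan: "set_encode {..<n} = 2 ^ n - 1"
  by (induction n) (simp_all add: lessThan_Suc set_encode_insert)

lemma set_encode_less: "s \<subseteq> {..<n} \<Longrightarrow> set_encode s < 2 ^ n"
  using set_encode_mono[of s "{..<n}"] le_less_trans[of "set_encode s" "2 ^ n - 1" "2 ^ n"]
  by (simp add: set_encode_lessThan)

lemma set_decode_subset: "u < 2 ^ n \<Longrightarrow> set_decode u \<subseteq> {..<n}"
proof
  fix i assume u: "u < 2 ^ n" and "i \<in> set_decode u"
  then have "2 ^ i \<le> u" by (auto simp: set_decode_def intro: ccontr)
  with u show "i \<in> {..<n}"
    by (metis lessThan_iff le_less_trans nat_power_less_imp_less pos2)
qed

lemma set_encode_remove: "i \<in> set_decode u \<Longrightarrow> set_encode (set_decode u - {i}) = u - 2 ^ i"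
  using set_encode_insert[of "set_decode u - {i}" i] by (simp add: insert_absorb)

text \<open>A positive shift drops low bits and divides the mask by \<open>2 ^ k\<close>. This makes
  increasing masks a legal order of filling: after a positive shift, a lookup hits an earlier
  entry.\<close>

lemma set_encode_ominus_less:
  assumes "finite u" "s \<subseteq> u" "u \<noteq> {}" "k > 0"
  shows "set_encode (s \<ominus> k) < set_encode u"
proof -
  have "set_encode (s \<ominus> k) * 2 ^ k = (\<Sum>j\<in>s \<ominus> k. 2 ^ (j + k))"
    by (simp add: set_encode_def power_add sum_distrib_right)
  also have "\<dots> = set_encode ((\<lambda>j. j + k) ` (s \<ominus> k))"
    unfolding set_encode_def by (subst sum.reindex) auto
  also have "\<dots> \<le> set_encode u"
    using assms by (intro set_encode_mono) (auto simp: mem_ominus)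
  finally have le: "set_encode (s \<ominus> k) * 2 ^ k \<le> set_encode u" .
  have pos: "set_encode u > 0"
    using set_encode_strict_mono[of "{}" u] assms by (simp add: psubset_eq)
  show ?thesis
  proof (cases "set_encode (s \<ominus> k) = 0")
    case False
    then have "set_encode (s \<ominus> k) * 1 < set_encode (s \<ominus> k) * 2 ^ k"
      using one_less_power[of "2::nat" k] assms(4) by (intro mult_strict_left_mono) auto
    from less_le_trans[OF this le] show ?thesis by simp
  qed (use pos in simp)
qed


section \<open>Weakest preconditions with running time\<close>

text \<open>An execution must exist, so a proof of \<open>wp\<close> certifies termination, word
  size and address bounds; the running time is passed to the postcondition.\<close>

definition wp :: "nat \<Rightarrow> nat \<Rightarrow> com \<Rightarrow> (nat \<Rightarrow> state \<Rightarrow> bool) \<Rightarrow> state \<Rightarrow> bool" where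
  "wp b m c Q \<sigma> \<longleftrightarrow> (\<exists>t \<sigma>'. exec b m c \<sigma> t \<sigma>' \<and> Q t \<sigma>')"

inductive_cases exec_SkipE: "exec b m Skip \<sigma> t \<sigma>'"
inductive_cases exec_ConstE: "exec b m (Const r v) \<sigma> t \<sigma>'"
inductive_cases exec_ArithE: "exec b m (Arith f r p q) \<sigma> t \<sigma>'"
inductive_cases exec_LoadE: "exec b m (Load r p) \<sigma> t \<sigma>'"
inductive_cases exec_StoreE: "exec b m (Store p q) \<sigma> t \<sigma>'"
inductive_cases exec_SeqE: "exec b m (Seq c1 c2) \<sigma> t \<sigma>'"
inductive_cases exec_IfLessE: "exec b m (IfLess p q c1 c2) \<sigma> t \<sigma>'"

text \<open>This and the following equivalences let the simplifier execute straight-line code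
  symbolically.\<close>

lemma wp_Skip [simp]: "wp b m Skip Q \<sigma> \<longleftrightarrow> Q 1 \<sigma>"
  by (cases \<sigma>) (auto simp: wp_def intro: exec.intros[unfolded One_nat_def] elim!: exec_SkipE)

lemma wp_Const [simp]: "wp b m (Const r v) Q (R, M) \<longleftrightarrow> v < 2 ^ b \<and> Q 1 (R(r := v), M)"
  by (auto simp: wp_def intro: exec.intros[unfolded One_nat_def] elim!: exec_ConstE)

lemma wp_Arith [simp]:
  "wp b m (Arith f r p q) Q (R, M) \<longleftrightarrow>
     arith_val f (R p) (R q) < 2 ^ b \<and> Q 1 (R(r := arith_val f (R p) (R q)), M)"
  by (auto simp: wp_def intro: exec.intros[unfolded One_nat_def] elim!: exec_ArithE)

lemma wp_Load [simp]: "wp b m (Load r p) Q (R, M) \<longleftrightarrow> R p < m \<and> Q 1 (R(r := M (R p)), M)"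
  by (auto simp: wp_def intro: exec.intros[unfolded One_nat_def] elim!: exec_LoadE)

lemma wp_Store [simp]: "wp b m (Store p q) Q (R, M) \<longleftrightarrow> R p < m \<and> Q 1 (R, M(R p := R q))"
  by (auto simp: wp_def intro: exec.intros[unfolded One_nat_def] elim!: exec_StoreE)

lemma wp_Seq [simp]:
  "wp b m (Seq c1 c2) Q \<sigma> \<longleftrightarrow> wp b m c1 (\<lambda>t1. wp b m c2 (\<lambda>t2. Q (t1 + t2))) \<sigma>"
  unfolding wp_def by (blast intro: exec.intros elim: exec_SeqE)

lemma wp_IfLess [simp]:
  "wp b m (IfLess p q c1 c2) Q (R, M) \<longleftrightarrow>
     (if R p < R q then wp b m c1 (\<lambda>t. Q (1 + t)) (R, M) else wp b m c2 (\<lambda>t. Q (1 + t)) (R, M))"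
    (is "_ \<longleftrightarrow> ?R")
proof
  assume ?R
  then show "wp b m (IfLess p q c1 c2) Q (R, M)"
    unfolding wp_def by (metis exec.IfTrue exec.IfFalse)
qed (auto simp: wp_def elim!: exec_IfLessE)

lemma wp_mono:
  assumes "wp b m c Q \<sigma>" "\<And>t R M. Q t (R, M) \<Longrightarrow> Q' t (R, M)"
  shows "wp b m c Q' \<sigma>"
  using assms unfolding wp_def by (metis surj_pair)

text \<open>The invariant is indexed by a counter, which decides the guard. Each round costs
  \<open>C\<close> plus one unit for the test; the last, failing test costs one more.\<close>

lemma wp_WhileLess:
  assumes "lo \<le> hi" and "I lo R M"
    and "\<And>k R M. k < hi \<Longrightarrow> I k R M \<Longrightarrow>
      R p < R q \<and> wp b m c (\<lambda>t (R', M'). t \<le> C \<and> I (Suc k) R' M') (R, M)"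
    and "\<And>R M. I hi R M \<Longrightarrow> \<not> R p < R q"
  shows "wp b m (WhileLess p q c) (\<lambda>t (R', M'). t \<le> (hi - lo) * (C + 1) + 1 \<and> I hi R' M') (R, M)"
  using assms(1,2)
proof (induction "hi - lo" arbitrary: lo R M)
  case 0
  then have "exec b m (WhileLess p q c) (R, M) 1 (R, M)"
    using assms(4) by (intro exec.WhileFalse) auto
  then show ?case
    using 0 unfolding wp_def by fastforce
next
  case (Suc d)
  note IH = Suc.hyps(1)
  have lo: "lo < hi" "d = hi - Suc lo" using Suc.hyps(2) by auto
  from assms(3)[OF lo(1) Suc.prems(2)] obtain t1 R1 M1 where
    1: "R p < R q" "exec b m c (R, M) t1 (R1, M1)" "t1 \<le> C" "I (Suc lo) R1 M1"
    by (auto simp: wp_def)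
  from IH[OF lo(2) _ 1(4)] lo(1) obtain t2 R2 M2 where
    2: "exec b m (WhileLess p q c) (R1, M1) t2 (R2, M2)" "t2 \<le> (hi - Suc lo) * (C + 1) + 1"
       "I hi R2 M2"
    by (auto simp: wp_def)
  have "hi - lo = Suc (hi - Suc lo)" using lo by simp
  then have "1 + t1 + t2 \<le> (hi - lo) * (C + 1) + 1"
    using 1(3) 2(2) by simp
  then show ?case
    using exec.WhileTrue[OF 1(1,2) 2(1)] 2(3) unfolding wp_def by fastforce
qed

text \<open>The closing \<open>Skip\<close> costs a unit, so four instructions in a block take time
  5.\<close>

fun block :: "com list \<Rightarrow> com" where
  "block [] = Skip"
| "block (c # cs) = Seq c (block cs)"

text \<open>Cuts code at an intermediate assertion. The nested blocks of the program mark the places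
  of these cuts.\<close>

lemma wp_blockI:
  assumes "wp b m c P \<sigma>" "\<And>t R M. P t (R, M) \<Longrightarrow> wp b m (block cs) (\<lambda>t2. Q (t + t2)) (R, M)"
  shows "wp b m (block (c # cs)) Q \<sigma>"
  using assms by (auto elim: wp_mono)


section \<open>The program\<close>

text \<open>
  Registers: 0 the length \<open>n\<close> of the pattern, which is also the address of the table of shifts;
  1 the address of the table of successors; 2 the size of the alphabet; 3, 14, 15 the constants
  1, 0, 2; 4 the number \<open>2 ^ n\<close>; 5 the mask \<open>U\<close> of the current set \<open>s \<union> {i}\<close>; 6, 7 its top
  bit \<open>h\<close> and \<open>2 ^ h\<close>; 8, 9 the position \<open>i\<close> and \<open>2 ^ i\<close>; 10, 21 some \<open>g \<in> s\<close>
  (\<open>g = i\<close> if \<open>s\<close> is empty) and \<open>2 ^ g\<close>; 11 the letter \<open>x\<close>; 12, 13 the shift and successor being computed; 16, 17 the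
  position and the letter read by a step; 18, 19 scratch; 20 the mask of \<open>s\<close>; 22 the letter
  of the pattern at \<open>i\<close>; 23, 24 the shift and successor for that letter.
\<close>

abbreviation copy :: "reg \<Rightarrow> reg \<Rightarrow> com" where
  "copy r p \<equiv> Arith Add r p 14"

text \<open>The outer test is the case where the position has fallen off. Otherwise register 19
  receives the row-major index of the entry; registers 0 and 1 turn it into addresses in the two
  tables.\<close>

definition step_com :: com where
  "step_com = IfLess 16 12 Skip (block
     [Arith Sub 18 16 12, Arith Mul 19 13 0, Arith Add 19 19 18, Arith Mul 19 19 2,
      Arith Add 19 19 17, Arith Add 18 19 0, Load 18 18, Arith Add 12 12 18,
      Arith Add 19 19 1, Load 13 19])"

text \<open>The subtraction clears bit \<open>g\<close> in the mask of \<open>s\<close>.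
  \<open>Load 17 10\<close> fetches the pattern letter at \<open>g\<close>, as the pattern starts at
  address 0.\<close>

definition remove_com :: com where
  "remove_com = block
     [block [Arith Sub 13 20 21, Const 12 0, copy 16 8, copy 17 11],
      step_com,
      block [copy 16 10, Load 17 10],
      step_com]"

definition singleton_com :: com where
  "singleton_com = block
     [block [Const 12 1, Const 13 0, copy 16 8, copy 17 11],
      step_com]"

text \<open>The only test is \<open><\<close>, so \<open>g \<noteq> i\<close> takes two comparisons.
  The innermost branch is \<open>g = i\<close>, that is, empty \<open>s\<close>.\<close>

definition mismatch_com :: com where
  "mismatch_com = IfLess 10 8 remove_com (IfLess 8 10 remove_com singleton_com)"

definition entry_com :: com where
  "entry_com = block
     [IfLess 11 22 mismatch_com (IfLess 22 11 mismatch_com (block [copy 12 23, copy 13 24])),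
      block [Arith Mul 19 20 0, Arith Add 19 19 8, Arith Mul 19 19 2, Arith Add 19 19 11,
        Arith Add 18 19 0, Store 18 12, Arith Add 19 19 1, Store 19 13, Arith Add 11 11 3]]"

text \<open>A finished position becomes the \<open>g\<close> of the positions after it.\<close>

definition letters_com :: com where
  "letters_com = block
     [block [Arith Sub 20 5 9, Load 22 8, Const 11 0],
      WhileLess 11 2 entry_com,
      block [copy 10 8, copy 21 9]]"

definition position_com :: com where
  "position_com = block
     [block [Arith Div 18 5 9, Arith Mod 18 18 15],
      IfLess 14 18 letters_com Skip,
      block [Arith Add 8 8 3, Arith Add 9 9 9]]"

text \<open>Reading begins at position 1: at shift 1 the letter at position 0 has already fallen
  off, which is also why the initial mask is 0.\<close>

definition period_com :: com where
  "period_com = block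
     [block [Const 12 1, Const 13 0, Const 16 1],
      WhileLess 16 0 (block [Load 17 16, step_com, Arith Add 16 16 3]),
      block [copy 23 12, copy 24 13]]"

definition match_com :: com where
  "match_com = block
     [Arith Add 18 5 3, IfLess 18 4 (block [Const 23 0, copy 24 5]) period_com]"

text \<open>The top bit is updated incrementally, moving up when \<open>U\<close> reaches twice its
  value. It provides the first \<open>g\<close>.\<close>

definition set_com :: com where
  "set_com = block
     [block [Arith Add 18 7 7, IfLess 5 18 Skip (block [copy 7 18, Arith Add 6 6 3])],
      match_com,
      block [copy 10 6, copy 21 7, Const 8 0, Const 9 1],
      WhileLess 8 0 position_com,
      Arith Add 5 5 3]"

text \<open>The alphabet is fixed, so its size may be a constant of the program. Registers 6, 8 and
  14 rely on their initial value 0.\<close>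

definition lattice_com :: "nat \<Rightarrow> com" where
  "lattice_com a = block
     [block [Const 2 a, Const 3 1, Const 15 2, Const 4 1],
      WhileLess 8 0 (block [Arith Add 4 4 4, Arith Add 8 8 3]),
      block [Arith Mul 1 0 4, Arith Mul 1 1 2, Arith Add 1 1 0, Const 5 1, Const 7 1],
      WhileLess 5 4 set_com]"


section \<open>Correctness and running time of the program\<close>

locale pattern_ram =
  fixes v :: "nat list" and a b :: nat
  assumes v_ne: "v \<noteq> []"
    and letter_less: "\<And>i. i < length v \<Longrightarrow> v ! i < a"
    and word: "length v + 2 * (length v * 2 ^ length v * a) < 2 ^ b"
begin

abbreviation n :: nat where "n \<equiv> length v"

definition tsize :: nat where "tsize = n * 2 ^ n * a"

definition m :: nat where "m = n + 2 * tsize"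

text \<open>Values occurring in the program are bounded by the memory size, so this inequality, with
  \<open>tsize_ge\<close>, settles the word-size conditions.\<close>

lemma m_less: "m < 2 ^ b"
  using word by (simp add: m_def tsize_def)

lemma n_pos: "0 < n" and a_pos: "0 < a"
  using v_ne letter_less[of 0] by auto

lemma tsize_ge: "2 ^ n \<le> tsize" "n \<le> tsize" "a \<le> tsize" "1 \<le> tsize" "n * 2 ^ n \<le> tsize"
  using n_pos a_pos by (simp_all add: tsize_def Suc_le_eq)

definition env :: "(reg \<Rightarrow> nat) \<Rightarrow> bool" where
  "env R \<longleftrightarrow> R 0 = n \<and> R 1 = n + tsize \<and> R 2 = a \<and> R 3 = 1 \<and> R 4 = 2 ^ n \<and> R 14 = 0 \<and> R 15 = 2"

definition pat :: "(nat \<Rightarrow> nat) \<Rightarrow> bool" where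
  "pat M \<longleftrightarrow> (\<forall>i<n. M i = v ! i)"

definition key :: "nat set \<Rightarrow> nat \<Rightarrow> nat \<Rightarrow> bool" where
  "key s i x \<longleftrightarrow> s \<subseteq> {..<n} \<and> i < n \<and> i \<notin> s \<and> x < a"

definition idx :: "nat set \<Rightarrow> nat \<Rightarrow> nat \<Rightarrow> nat" where
  "idx s i x = (set_encode s * n + i) * a + x"

text \<open>The invariant shared by the loops over sets, positions and letters: all entries that
  precede \<open>(U, i, x)\<close> in lexicographic order, with the mask of the union as first
  component, are correct.\<close>

definition filled :: "nat \<Rightarrow> nat \<Rightarrow> nat \<Rightarrow> (nat \<Rightarrow> nat) \<Rightarrow> bool" where
  "filled U i x M \<longleftrightarrow> (\<forall>s' i' x'. key s' i' x' \<longrightarrow>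
     (set_encode (insert i' s') < U \<or>
      set_encode (insert i' s') = U \<and> (i' < i \<or> i' = i \<and> x' < x)) \<longrightarrow>
     M (n + idx s' i' x') = lattice_shift v s' i' x' \<and>
     M (n + tsize + idx s' i' x') = set_encode (lattice_next v s' i' x'))"

lemma idx_less:
  assumes "key s i x" shows "idx s i x < tsize"
proof -
  have "Suc (set_encode s * n + i) \<le> Suc (set_encode s) * n"
    using assms by (simp add: key_def)
  also have "\<dots> \<le> 2 ^ n * n"
    using assms set_encode_less[of s n] by (intro mult_right_mono) (auto simp: key_def)
  finally have "Suc (set_encode s * n + i) * a \<le> 2 ^ n * n * a" by (rule mult_right_mono) simp
  moreover have "idx s i x < Suc (set_encode s * n + i) * a"
    using assms by (simp add: idx_def key_def)
  ultimately show ?thesis by (simp add: tsize_def mult_ac)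
qed

text \<open>Bounds the intermediate results of the address computation.\<close>

lemma idx_parts_less:
  assumes "key s i x"
  shows "set_encode s * n < tsize" "set_encode s * n + i < tsize"
    "(set_encode s * n + i) * a < tsize"
proof -
  have "set_encode s * n + i \<le> (set_encode s * n + i) * a" using a_pos by simp
  moreover have "(set_encode s * n + i) * a < tsize"
    using idx_less[OF assms] by (simp add: idx_def)
  ultimately show "set_encode s * n < tsize" "set_encode s * n + i < tsize"
    "(set_encode s * n + i) * a < tsize" by linarith+
qed

lemma idx_inject:
  assumes "key s i x" "key s' i' x'" "idx s i x = idx s' i' x'"
  shows "s = s' \<and> i = i' \<and> x = x'"
proof -
  have "x = idx s i x mod a" "set_encode s * n + i = idx s i x div a"
       "x' = idx s' i' x' mod a" "set_encode s' * n + i' = idx s' i' x' div a"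
    using assms(1,2) by (simp_all add: idx_def key_def)
  with assms(3) have eq: "x = x'" "set_encode s * n + i = set_encode s' * n + i'" by auto
  have "i = (set_encode s * n + i) mod n" "set_encode s = (set_encode s * n + i) div n"
       "i' = (set_encode s' * n + i') mod n" "set_encode s' = (set_encode s' * n + i') div n"
    using assms(1,2) n_pos by (simp_all add: key_def div_mult_self3)
  with eq(2) have "i = i'" "set_encode s = set_encode s'" by auto
  moreover have "finite s" "finite s'"
    using assms(1,2) by (auto simp: key_def intro: finite_subset)
  ultimately show ?thesis using eq(1) by (metis set_encode_inverse)
qed

lemma filled_store:
  assumes "filled U i x M" "key s i x" "U = set_encode (insert i s)"
  shows "filled U i (Suc x) (M(n + idx s i x := lattice_shift v s i x,
           n + tsize + idx s i x := set_encode (lattice_next v s i x)))"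
  unfolding filled_def
proof (intro allI impI)
  let ?M = "M(n + idx s i x := lattice_shift v s i x,
           n + tsize + idx s i x := set_encode (lattice_next v s i x))"
  fix s' i' x' assume k: "key s' i' x'"
    and lt: "set_encode (insert i' s') < U \<or>
      set_encode (insert i' s') = U \<and> (i' < i \<or> i' = i \<and> x' < Suc x)"
  note less = idx_less[OF k] idx_less[OF assms(2)]
  show "?M (n + idx s' i' x') = lattice_shift v s' i' x' \<and>
     ?M (n + tsize + idx s' i' x') = set_encode (lattice_next v s' i' x')"
  proof (cases "idx s' i' x' = idx s i x")
    case True
    with idx_inject[OF k assms(2)] less show ?thesis by auto
  next
    case False
    have "\<not> (set_encode (insert i' s') = U \<and> i' = i \<and> x' = x)"
    proof
      assume *: "set_encode (insert i' s') = U \<and> i' = i \<and> x' = x"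
      have "finite s" "finite s'"
        using assms(2) k by (auto simp: key_def intro: finite_subset)
      \<comment> \<open>Equal masks give equal unions, and \<open>i\<close> lies in neither
        \<open>s\<close> nor \<open>s'\<close>, so the sets themselves agree.\<close>
      with * assms(3) have "insert i s' = insert i s"
        by (metis finite_insert set_encode_inverse)
      then have "s' = s" using * k assms(2) unfolding key_def by (metis insert_ident)
      with * False show False by simp
    qed
    with lt have "set_encode (insert i' s') < U \<or>
      set_encode (insert i' s') = U \<and> (i' < i \<or> i' = i \<and> x' < x)" by auto
    with assms(1) k have "M (n + idx s' i' x') = lattice_shift v s' i' x' \<and>
       M (n + tsize + idx s' i' x') = set_encode (lattice_next v s' i' x')"
      unfolding filled_def by blast
    with less False show ?thesis by simp
  qed
qed

text \<open>All letters of a \<open>key\<close> are below \<open>a\<close>, so position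
  \<open>i\<close> is exhausted.\<close>

lemma filled_next_position: "filled U i a M \<Longrightarrow> filled U (Suc i) 0 M"
  unfolding filled_def key_def by (metis less_Suc_eq not_less0)

text \<open>No entry belongs to a position outside the union, so there is nothing to fill.\<close>

lemma filled_skip_position:
  assumes "filled U i 0 M" "i \<notin> set_decode U" shows "filled U (Suc i) 0 M"
proof -
  have "i' \<noteq> i" if "key s' i' x'" "set_encode (insert i' s') = U" for s' i' x'
  proof -
    have "finite s'" using that by (auto simp: key_def intro: finite_subset)
    with that(2) have "insert i' s' = set_decode U" by (metis finite_insert set_encode_inverse)
    with assms(2) show ?thesis by auto
  qed
  with assms(1) show ?thesis unfolding filled_def by (metis less_Suc_eq not_less0)
qed

lemma filled_next_set: "filled U n 0 M \<Longrightarrow> filled (Suc U) 0 0 M"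
  unfolding filled_def key_def by (metis less_Suc_eq not_less0)

section \<open>Reading letters by table lookup; entries with a mismatching letter\<close>

definition tracks :: "(nat \<rightharpoonup> nat) \<Rightarrow> nat \<Rightarrow> (reg \<Rightarrow> nat) \<Rightarrow> bool" where
  "tracks f k0 R \<longleftrightarrow> dom f \<subseteq> {..<n} \<and> first_fit v f k0 (R 12) \<and> R 13 = set_encode (dom f \<ominus> R 12)"

text \<open>Hypothesis \<open>small\<close> places the lookup among the entries already filled. It
  also keeps the looked-up union from being full, as \<open>first_fit_step\<close> requires.\<close>

lemma wp_step:
  assumes "env R" "filled U i x M" "U < 2 ^ n" "tracks f k0 R" "k0 \<le> n"
    and j: "R 16 < n" "R 16 \<notin> dom f" and c: "R 17 < a"
    and small: "R 12 \<le> R 16 \<Longrightarrow> set_encode (insert (R 16) (dom f) \<ominus> R 12) < U"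
  shows "wp b m step_com (\<lambda>t (R', M'). t \<le> 20 \<and> M' = M \<and>
      (\<forall>r. r \<notin> {12, 13, 18, 19} \<longrightarrow> R' r = R r) \<and>
      tracks (f(R 16 \<mapsto> R 17)) k0 R') (R, M)"
proof -
  define k where "k = R 12"
  define j where "j = R 16"
  define c where "c = R 17"
  define T where "T = dom f \<ominus> k"
  note R = k_def[symmetric] j_def[symmetric] c_def[symmetric]
  note * = assms(4)[unfolded tracks_def R, folded T_def] and j' = j[unfolded R]
    and c' = c[unfolded R] and small' = small[unfolded R]
  have dom: "dom f \<subseteq> {..<n}" and fit: "first_fit v f k0 k" and R13: "R 13 = set_encode T"
    using * by auto
  have dom': "dom (f(j \<mapsto> c)) = insert j (dom f)" "dom (f(j \<mapsto> c)) \<subseteq> {..<n}"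
    using dom j' by auto
  show ?thesis
  proof (cases "j < k")
    case True
    then have "tracks (f(j \<mapsto> c)) k0 R"
      using first_fit_skip(1)[OF fit j'(2) True, of c] first_fit_skip(2)[OF fit j'(2) True] dom' R13
      by (simp add: tracks_def R T_def)
    with True show ?thesis by (simp add: step_com_def R)
  next
    case False
    have T: "T \<subseteq> {..<n}" "j - k \<notin> T"
      using ominus_subset[OF dom] j'(2) False by (auto simp: T_def mem_ominus)
    have key: "key T (j - k) c" using T j' c' by (simp add: key_def)
    have lt: "set_encode (insert (j - k) T) < U"
      using small' False by (simp add: ominus_insert T_def)
    \<comment> \<open>Otherwise the union would be full and have the largest mask
      \<open>2 ^ n - 1\<close>, which is not below \<open>U\<close>.\<close>
    have "card T \<noteq> n - 1"
    proof
      assume "card T = n - 1"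
      then have "card (insert (j - k) T) = n"
        using T n_pos finite_subset[OF T(1)] by simp
      then have "insert (j - k) T = {..<n}"
        using T j' by (intro card_subset_eq) auto
      with lt assms(3) show False by (simp add: set_encode_lessThan)
    qed
    note step = first_fit_step[OF dom fit j' _ this[unfolded T_def], of c, folded T_def]
    let ?d = "lattice_shift v T (j - k) c"
    have fit': "first_fit v (f(j \<mapsto> c)) k0 (k + ?d)" and
      next': "insert j (dom f) \<ominus> (k + ?d) = lattice_next v T (j - k) c"
      using step False by auto
    have tab: "M (n + idx T (j - k) c) = ?d"
      "M (n + tsize + idx T (j - k) c) = set_encode (lattice_next v T (j - k) c)"
      using assms(2) key lt unfolding filled_def by auto
    have "k + ?d \<le> n" by (rule first_fit_le_length[OF fit' dom'(2) assms(5)])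
    note bounds = this m_less idx_less[OF key] idx_parts_less[OF key] tsize_ge j'(1) c'
    have tr: "tracks (f(j \<mapsto> c)) k0 R'"
      if "R' 12 = k + ?d" "R' 13 = set_encode (lattice_next v T (j - k) c)" for R'
      using fit' dom' next' that by (simp add: tracks_def)
    define d where "d = j - k"
    have "d < n" using j'(1) by (simp add: d_def)
    \<comment> \<open>The summands are put in the order in which the program adds them.\<close>
    moreover have tab': "M (idx T d c + n) = lattice_shift v T d c"
      "M (idx T d c + (n + tsize)) = set_encode (lattice_next v T d c)"
      using tab by (simp_all add: d_def add_ac)
    ultimately show ?thesis
      using False bounds assms(1) tr unfolding d_def[symmetric]
      by (simp add: step_com_def R R13 env_def idx_def[symmetric] m_def d_def[symmetric]
          del: dom_fun_upd)
  qed
qed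

text \<open>The wrong letter at \<open>i\<close> rules out shift 0, so the starts 0 and 1 give the
  same least fit. Hence it is irrelevant here whether the union is full.\<close>

lemma mismatch_result:
  assumes "tracks ((letters_at v s)(i \<mapsto> x)) k0 R" "k0 \<le> 1" "i \<notin> s" "v ! i \<noteq> x"
  shows "R 12 = lattice_shift v s i x" "R 13 = set_encode (lattice_next v s i x)"
proof -
  let ?f = "(letters_at v s)(i \<mapsto> x)"
  have fit: "first_fit v ?f k0 (R 12)" and R13: "R 13 = set_encode (insert i s \<ominus> R 12)"
    using assms(1) by (simp_all add: tracks_def)
  have no: "\<not> agrees v ?f 0" using assms(4) by (intro not_agrees_0[of _ i x]) auto
  with fit have "R 12 \<noteq> 0" by (metis first_fit_def)
  have "first_fit v ?f k1 (R 12)" if "k1 \<le> 1" for k1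
  proof (rule first_fit_change_start[OF fit])
    show "k1 \<le> R 12" using that \<open>R 12 \<noteq> 0\<close> by simp
    fix k' assume "k' < k0"
    then have "k' = 0" using assms(2) by simp
    with no show "\<not> agrees v ?f k'" by simp
  qed
  then show eq: "R 12 = lattice_shift v s i x"
    using lattice_shift_eqI[OF assms(3), of v x "R 12"] by simp
  show "R 13 = set_encode (lattice_next v s i x)"
    using R13 by (simp add: lattice_next_def eq[symmetric])
qed

lemma letter_bound: "i < n \<Longrightarrow> v ! i < 2 ^ b"
  using letter_less[of i] tsize_ge m_less by (simp add: m_def)

text \<open>\<open>g = i\<close> signals that \<open>s\<close> is empty.\<close>

definition at_position :: "nat \<Rightarrow> nat \<Rightarrow> nat \<Rightarrow> (reg \<Rightarrow> nat) \<Rightarrow> bool" where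
  "at_position U i g R \<longleftrightarrow> U < 2 ^ n \<and> i \<in> set_decode U \<and> g \<in> set_decode U \<and> (g = i \<longrightarrow> U = 2 ^ i) \<and>
     R 5 = U \<and> R 8 = i \<and> R 10 = g \<and> R 20 = U - 2 ^ i \<and> R 21 = 2 ^ g \<and> R 22 = v ! i"

lemma wp_singleton:
  assumes "env R" "filled U i x M" and at: "at_position U i i R"
    and x: "R 11 = x" "x < a"
  shows "wp b m singleton_com (\<lambda>t (R', M'). t \<le> 60 \<and> M' = M \<and>
      (\<forall>r. r \<notin> {12, 13, 16, 17, 18, 19} \<longrightarrow> R' r = R r) \<and>
      tracks ((letters_at v (set_decode U - {i}))(i \<mapsto> x)) 1 R') (R, M)"
proof -
  have U: "U = 2 ^ i" "set_decode U = {i}"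
    using at set_encode_inverse[of "{i}"] set_encode_insert[of "{}" i]
    by (auto simp: at_position_def)
  have i: "i < n" using at by (simp add: at_position_def U)
  note b = m_less[unfolded m_def] tsize_ge
  have ini: "wp b m (block [Const 12 1, Const 13 0, copy 16 8, copy 17 11])
    (\<lambda>t (R', M'). t \<le> 5 \<and> M' = M \<and> (\<forall>r. r \<notin> {12, 13, 16, 17} \<longrightarrow> R' r = R r) \<and>
       R' 12 = 1 \<and> R' 13 = 0 \<and> R' 16 = i \<and> R' 17 = x) (R, M)"
    using assms(1) at x i b by (simp add: env_def at_position_def)
  show ?thesis unfolding singleton_com_def
  proof (rule wp_blockI[OF ini], unfold prod.case, elim conjE)
    fix t :: nat and R1 :: "reg \<Rightarrow> nat" and M1
    assume M: "M1 = M" and R1: "t \<le> 5" "\<forall>r. r \<notin> {12, 13, 16, 17} \<longrightarrow> R1 r = R r"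
      "R1 12 = 1" "R1 13 = 0" "R1 16 = i" "R1 17 = x"
    have "env R1" using assms(1) R1 by (simp add: env_def)
    moreover have "tracks Map.empty 1 R1"
      using R1 by (simp add: tracks_def first_fit_def agrees_def ominus_def)
    \<comment> \<open>The lookup is at \<open>{i - 1}\<close>; for \<open>i = 0\<close> the step
      skips the letter.\<close>
    moreover have "set_encode (insert i {} \<ominus> 1) < U" if "1 \<le> i"
      using that U set_encode_ominus_less[of "{i}" "{i}" 1] by simp
    ultimately have "wp b m step_com (\<lambda>t (R', M'). t \<le> 20 \<and> M' = M \<and>
      (\<forall>r. r \<notin> {12, 13, 18, 19} \<longrightarrow> R' r = R1 r) \<and>
      tracks (Map.empty(R1 16 \<mapsto> R1 17)) 1 R') (R1, M)"
      using assms(2) R1 x i at n_pos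
      by (intro wp_step) (auto simp: at_position_def)
    then show "wp b m (block [step_com])
      (\<lambda>t2 (R', M'). t + t2 \<le> 60 \<and> M' = M \<and>
      (\<forall>r. r \<notin> {12, 13, 16, 17, 18, 19} \<longrightarrow> R' r = R r) \<and>
      tracks ((letters_at v (set_decode U - {i}))(i \<mapsto> x)) 1 R') (R1, M1)"
      unfolding block.simps wp_Seq M
      by (rule wp_mono) (use R1 U in auto)
  qed
qed

lemma wp_remove:
  assumes "env R" "pat M" "filled U i x M" and at: "at_position U i g R" and "g \<noteq> i"
    and x: "R 11 = x" "x < a" "v ! i \<noteq> x"
  shows "wp b m remove_com (\<lambda>t (R', M'). t \<le> 60 \<and> M' = M \<and>
      (\<forall>r. r \<notin> {12, 13, 16, 17, 18, 19} \<longrightarrow> R' r = R r) \<and>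
      tracks ((letters_at v (set_decode U - {i}))(i \<mapsto> x)) 0 R') (R, M)"
proof -
  let ?u = "set_decode U"
  let ?f = "letters_at v (?u - {i} - {g})"
  have U: "U < 2 ^ n" and sub: "?u \<subseteq> {..<n}" and mem: "i \<in> ?u" "g \<in> ?u"
    using at set_decode_subset[of U n] by (auto simp: at_position_def)
  then have ig: "i < n" "g < n" by auto
  have enc: "set_encode (?u - {i} - {g}) = U - 2 ^ i - 2 ^ g"
  proof -
    have "set_decode (U - 2 ^ i) = ?u - {i}"
      using mem(1) by (simp flip: set_encode_remove)
    then show ?thesis
      using set_encode_remove[of g "U - 2 ^ i"] mem(2) \<open>g \<noteq> i\<close> by simp
  qed
  note b = m_less[unfolded m_def] tsize_ge
  have ini: "wp b m (block [Arith Sub 13 20 21, Const 12 0, copy 16 8, copy 17 11])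
    (\<lambda>t (R', M'). t \<le> 5 \<and> M' = M \<and> (\<forall>r. r \<notin> {12, 13, 16, 17} \<longrightarrow> R' r = R r) \<and>
       R' 12 = 0 \<and> R' 13 = set_encode (?u - {i} - {g}) \<and> R' 16 = i \<and> R' 17 = x) (R, M)"
  proof -
    have "U - (2 ^ i + 2 ^ g) < 2 ^ b"
      using U b by (intro le_less_trans[OF diff_le_self]) linarith
    then show ?thesis
      using assms(1) at x ig b by (simp add: env_def at_position_def enc)
  qed
  show ?thesis unfolding remove_com_def
  proof (rule wp_blockI[OF ini], unfold prod.case, elim conjE)
    fix t :: nat and R1 :: "reg \<Rightarrow> nat" and M1
    assume M: "M1 = M" and R1: "t \<le> 5" "\<forall>r. r \<notin> {12, 13, 16, 17} \<longrightarrow> R1 r = R r"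
      "R1 12 = 0" "R1 13 = set_encode (?u - {i} - {g})" "R1 16 = i" "R1 17 = x"
    have "env R1" using assms(1) R1 by (simp add: env_def)
    moreover have "tracks ?f 0 R1"
      using R1 sub by (auto simp: tracks_def first_fit_def)
    \<comment> \<open>First lookup: nothing is shifted yet, but \<open>g\<close> is missing, which
      lowers the mask.\<close>
    moreover have "set_encode (insert i (?u - {i} - {g})) < U"
    proof -
      have "set_encode (insert i (?u - {i} - {g})) < set_encode ?u"
        using mem \<open>g \<noteq> i\<close> by (intro set_encode_strict_mono) auto
      then show ?thesis by simp
    qed
    ultimately have step: "wp b m step_com (\<lambda>t (R', M'). t \<le> 20 \<and> M' = M \<and>
      (\<forall>r. r \<notin> {12, 13, 18, 19} \<longrightarrow> R' r = R1 r) \<and>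
      tracks (?f(R1 16 \<mapsto> R1 17)) 0 R') (R1, M)"
      using assms(3) R1 x ig U
      by (intro wp_step) auto
    show "wp b m (block [step_com, block [copy 16 10, Load 17 10], step_com])
      (\<lambda>t2 (R', M'). t + t2 \<le> 60 \<and> M' = M \<and>
      (\<forall>r. r \<notin> {12, 13, 16, 17, 18, 19} \<longrightarrow> R' r = R r) \<and>
      tracks ((letters_at v (?u - {i}))(i \<mapsto> x)) 0 R') (R1, M1)"
    unfolding M
    proof (rule wp_blockI[OF step], unfold prod.case, elim conjE)
      fix t' :: nat and R2 :: "reg \<Rightarrow> nat" and M2
      assume M: "M2 = M" and R2: "t' \<le> 20" "\<forall>r. r \<notin> {12, 13, 18, 19} \<longrightarrow> R2 r = R1 r"
        "tracks (?f(R1 16 \<mapsto> R1 17)) 0 R2"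
      have ini: "wp b m (block [copy 16 10, Load 17 10])
        (\<lambda>t (R', M'). t \<le> 5 \<and> M' = M \<and> (\<forall>r. r \<notin> {16, 17} \<longrightarrow> R' r = R2 r) \<and>
          R' 16 = g \<and> R' 17 = v ! g) (R2, M)"
        using assms(1,2) at R1 R2 x ig b by (simp add: env_def at_position_def pat_def m_def)
      show "wp b m (block [block [copy 16 10, Load 17 10], step_com])
        (\<lambda>t2 (R', M'). t + (t' + t2) \<le> 60 \<and> M' = M \<and>
        (\<forall>r. r \<notin> {12, 13, 16, 17, 18, 19} \<longrightarrow> R' r = R r) \<and>
        tracks ((letters_at v (?u - {i}))(i \<mapsto> x)) 0 R') (R2, M2)"
      unfolding M
      proof (rule wp_blockI[OF ini], unfold prod.case, elim conjE)
        fix t'' :: nat and R3 :: "reg \<Rightarrow> nat" and M3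
        assume M: "M3 = M" and R3: "t'' \<le> 5" "\<forall>r. r \<notin> {16, 17} \<longrightarrow> R3 r = R2 r" "R3 16 = g" "R3 17 = v ! g"
        have "env R3" using assms(1) R1 R2 R3 by (simp add: env_def)
        moreover have tr: "tracks (?f(i \<mapsto> x)) 0 R3"
          using R1 R2 R3 by (simp add: tracks_def)
        \<comment> \<open>Second lookup: \<open>x\<close> has forced a positive shift, which lowers
          the mask even with \<open>g\<close> put back.\<close>
        moreover have "R3 12 \<noteq> 0"
          using tr not_agrees_0[of "?f(i \<mapsto> x)" i x v] x(3) by (auto simp: tracks_def first_fit_def)
        then have "set_encode (insert g (dom (?f(i \<mapsto> x))) \<ominus> R3 12) < set_encode ?u"
          using mem by (intro set_encode_ominus_less) auto
        ultimately have "wp b m step_com (\<lambda>t (R', M'). t \<le> 20 \<and> M' = M \<and>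
            (\<forall>r. r \<notin> {12, 13, 18, 19} \<longrightarrow> R' r = R3 r) \<and>
            tracks (?f(i \<mapsto> x, R3 16 \<mapsto> R3 17)) 0 R') (R3, M)"
          using assms(3) R3 x ig U \<open>g \<noteq> i\<close> letter_less[of g]
          by (intro wp_step) auto
        moreover have "?f(i \<mapsto> x, g \<mapsto> v ! g) = (letters_at v (?u - {i}))(i \<mapsto> x)"
          using mem \<open>g \<noteq> i\<close> letters_at_insert[of v g "?u - {i} - {g}"]
          by (simp add: fun_upd_twist insert_absorb)
        ultimately show "wp b m (block [step_com])
          (\<lambda>t2 (R', M'). t + (t' + (t'' + t2)) \<le> 60 \<and> M' = M \<and>
          (\<forall>r. r \<notin> {12, 13, 16, 17, 18, 19} \<longrightarrow> R' r = R r) \<and>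
          tracks ((letters_at v (?u - {i}))(i \<mapsto> x)) 0 R') (R3, M3)"
          unfolding block.simps wp_Seq M
          by (elim wp_mono) (use R1 R2 R3 in auto)
      qed
    qed
  qed
qed

lemma wp_mismatch:
  assumes "env R" "pat M" "filled U i x M" and at: "at_position U i g R"
    and x: "R 11 = x" "x < a" "v ! i \<noteq> x"
  shows "wp b m mismatch_com (\<lambda>t (R', M'). t \<le> 62 \<and> M' = M \<and>
      (\<forall>r. r \<notin> {12, 13, 16, 17, 18, 19} \<longrightarrow> R' r = R r) \<and>
      R' 12 = lattice_shift v (set_decode U - {i}) i x \<and>
      R' 13 = set_encode (lattice_next v (set_decode U - {i}) i x)) (R, M)"
proof -
  have R: "R 8 = i" "R 10 = g" using at by (simp_all add: at_position_def)
  note result = mismatch_result[where s = "set_decode U - {i}" and i = i and x = x, OF _ _ _ x(3)]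
  consider "g < i" | "i < g" | "g = i" by linarith
  then show ?thesis
  proof cases
    case 1
    then have "wp b m remove_com (\<lambda>t (R', M'). t \<le> 60 \<and> M' = M \<and>
      (\<forall>r. r \<notin> {12, 13, 16, 17, 18, 19} \<longrightarrow> R' r = R r) \<and>
      tracks ((letters_at v (set_decode U - {i}))(i \<mapsto> x)) 0 R') (R, M)"
      using wp_remove[OF assms(1-4) _ x] by simp
    with 1 R show ?thesis unfolding mismatch_com_def
      by (simp del: insert_iff) (elim wp_mono, use result[of 0] in auto)
  next
    case 2
    then have "wp b m remove_com (\<lambda>t (R', M'). t \<le> 60 \<and> M' = M \<and>
      (\<forall>r. r \<notin> {12, 13, 16, 17, 18, 19} \<longrightarrow> R' r = R r) \<and>
      tracks ((letters_at v (set_decode U - {i}))(i \<mapsto> x)) 0 R') (R, M)"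
      using wp_remove[OF assms(1-4) _ x] by simp
    with 2 R show ?thesis unfolding mismatch_com_def
      by (simp del: insert_iff) (elim wp_mono, use result[of 0] in auto)
  next
    case 3
    then have "wp b m singleton_com (\<lambda>t (R', M'). t \<le> 60 \<and> M' = M \<and>
      (\<forall>r. r \<notin> {12, 13, 16, 17, 18, 19} \<longrightarrow> R' r = R r) \<and>
      tracks ((letters_at v (set_decode U - {i}))(i \<mapsto> x)) 1 R') (R, M)"
      using wp_singleton[OF assms(1,3) _ x(1,2)] at by simp
    with 3 R show ?thesis unfolding mismatch_com_def
      by (simp del: insert_iff) (elim wp_mono, use result[of 1] in auto)
  qed
qed

text \<open>For the matching letter the known letters are those of \<open>v\<close> on the whole
  union, whatever \<open>i\<close> is. One pair of values, computed once per union, serves all its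
  positions.\<close>

definition match_values :: "nat \<Rightarrow> (reg \<Rightarrow> nat) \<Rightarrow> bool" where
  "match_values U R \<longleftrightarrow> (\<forall>i \<in> set_decode U.
     lattice_shift v (set_decode U - {i}) i (v ! i) = R 23 \<and>
     set_encode (lattice_next v (set_decode U - {i}) i (v ! i)) = R 24)"

lemma lattice_values_le:
  assumes "key s i x"
  shows "lattice_shift v s i x \<le> n" "set_encode (lattice_next v s i x) < 2 ^ n"
proof -
  have k: "i \<notin> s" "s \<subseteq> {..<n}" "i < n" using assms by (auto simp: key_def)
  show "lattice_shift v s i x \<le> n"
    using first_fit_le_length[OF first_fit_lattice_shift[OF k]] k n_pos by auto
  show "set_encode (lattice_next v s i x) < 2 ^ n"
    unfolding lattice_next_def using k by (intro set_encode_less ominus_subset) auto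
qed

section \<open>The loops over letters and positions\<close>

lemma wp_entry:
  assumes "env R" "pat M" "filled U i x M" and at: "at_position U i g R"
    and mv: "match_values U R" and x: "R 11 = x" "x < a"
  shows "wp b m entry_com (\<lambda>t (R', M'). t \<le> 100 \<and> pat M' \<and> filled U i (Suc x) M' \<and> R' 11 = Suc x \<and>
      (\<forall>r. r \<notin> {11, 12, 13, 16, 17, 18, 19} \<longrightarrow> R' r = R r)) (R, M)"
proof -
  let ?u = "set_decode U"
  define s where "s = ?u - {i}"
  have U: "U < 2 ^ n" and sub: "?u \<subseteq> {..<n}" and mem: "i \<in> ?u"
    using at set_decode_subset[of U n] by (auto simp: at_position_def)
  have key: "key s i x" using sub mem x by (auto simp: s_def key_def)
  have s: "set_encode s = U - 2 ^ i" "U = set_encode (insert i s)"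
    using set_encode_remove[OF mem] mem by (auto simp: s_def insert_absorb)
  note b = m_less[unfolded m_def] tsize_ge
  let ?V = "\<lambda>R'. R' 12 = lattice_shift v s i x \<and> R' 13 = set_encode (lattice_next v s i x)"
  have 1: "wp b m (IfLess 11 22 mismatch_com (IfLess 22 11 mismatch_com
                    (block [copy 12 23, copy 13 24])))
      (\<lambda>t (R', M'). t \<le> 64 \<and> M' = M \<and>
      (\<forall>r. r \<notin> {12, 13, 16, 17, 18, 19} \<longrightarrow> R' r = R r) \<and> ?V R') (R, M)"
  proof (cases "v ! i = x")
    case True
    have "R 23 = lattice_shift v s i x" "R 24 = set_encode (lattice_next v s i x)"
      using mv mem True by (auto simp: match_values_def s_def)
    then show ?thesis
      using True at x b assms(1) lattice_values_le[OF key]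
      by (simp add: at_position_def env_def)
  next
    case False
    note * = wp_mismatch[OF assms(1-4) x False, folded s_def]
    have R: "R 11 = x" "R 22 = v ! i" using x at by (auto simp: at_position_def)
    then have "x < v ! i \<or> \<not> x < v ! i \<and> v ! i < x" using False by linarith
    with R show ?thesis
      by (auto simp del: insert_iff intro: wp_mono[OF *])
  qed
  show ?thesis unfolding entry_com_def
  proof (rule wp_blockI[OF 1], unfold prod.case, elim conjE)
    fix t :: nat and R1 :: "reg \<Rightarrow> nat" and M1
    assume M: "M1 = M" and R1: "t \<le> 64" "\<forall>r. r \<notin> {12, 13, 16, 17, 18, 19} \<longrightarrow> R1 r = R r"
      "R1 12 = lattice_shift v s i x" "R1 13 = set_encode (lattice_next v s i x)"
    have R: "R1 20 = set_encode s" "R1 8 = i" "R1 11 = x"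
       "R1 0 = n" "R1 1 = n + tsize" "R1 2 = a" "R1 3 = 1"
      using R1 at s x assms(1) by (auto simp: at_position_def env_def)
    let ?M = "M(idx s i x + n := lattice_shift v s i x,
           idx s i x + (n + tsize) := set_encode (lattice_next v s i x))"
    have "filled U i (Suc x) ?M"
      using filled_store[OF assms(3) key s(2)] by (simp add: add_ac)
    moreover have "pat ?M" using assms(2) by (auto simp: pat_def)
    ultimately show "wp b m (block [block [Arith Mul 19 20 0, Arith Add 19 19 8, Arith Mul 19 19 2,
        Arith Add 19 19 11, Arith Add 18 19 0, Store 18 12, Arith Add 19 19 1, Store 19 13,
        Arith Add 11 11 3]])
       (\<lambda>t2 (R', M'). t + t2 \<le> 100 \<and> pat M' \<and> filled U i (Suc x) M' \<and> R' 11 = Suc x \<and>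
      (\<forall>r. r \<notin> {11, 12, 13, 16, 17, 18, 19} \<longrightarrow> R' r = R r)) (R1, M1)"
      unfolding M using R1 R idx_less[OF key] idx_parts_less[OF key] b x
      by (simp add: idx_def[symmetric] m_def)
  qed
qed

text \<open>Until the first element of the set is passed, \<open>g\<close> is its top element;
  afterwards \<open>g\<close> lies below \<open>i\<close>. Hence \<open>g = i\<close> can occur at
  an element \<open>i\<close> only for a singleton.\<close>

definition scan :: "nat \<Rightarrow> nat \<Rightarrow> nat \<Rightarrow> (reg \<Rightarrow> nat) \<Rightarrow> bool" where
  "scan U i g R \<longleftrightarrow> U < 2 ^ n \<and> g \<in> set_decode U \<and> (g < i \<or> set_decode U \<subseteq> {i..g}) \<and>
     R 5 = U \<and> R 8 = i \<and> R 9 = 2 ^ i \<and> R 10 = g \<and> R 21 = 2 ^ g"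

lemma wp_letters:
  assumes "env R" "pat M" "filled U i 0 M" and scan: "scan U i g R" and i: "i \<in> set_decode U"
    and mv: "match_values U R"
  shows "wp b m letters_com
      (\<lambda>t (R', M'). t \<le> a * 101 + 10 \<and> pat M' \<and> filled U i a M' \<and> R' 10 = i \<and> R' 21 = 2 ^ i \<and>
         (\<forall>r. r \<notin> {10, 11, 12, 13, 16, 17, 18, 19, 20, 21, 22} \<longrightarrow> R' r = R r)) (R, M)"
proof -
  have U: "U < 2 ^ n" and "i < n"
    using scan i set_decode_subset[of U n] by (auto simp: scan_def)
  note b = m_less[unfolded m_def] tsize_ge
  have "2 ^ i < (2::nat) ^ b"
  proof -
    have "2 ^ i < (2::nat) ^ n" using \<open>i < n\<close> by simp
    with b show ?thesis by linarith
  qed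
  then have "i < b" by simp
  have ini: "wp b m (block [Arith Sub 20 5 9, Load 22 8, Const 11 0])
      (\<lambda>t (R', M'). t \<le> 4 \<and> M' = M \<and> (\<forall>r. r \<notin> {11, 20, 22} \<longrightarrow> R' r = R r) \<and>
        R' 11 = 0 \<and> R' 20 = U - 2 ^ i \<and> R' 22 = v ! i) (R, M)"
    using assms(1,2) scan U \<open>i < n\<close> b le_less_trans[OF diff_le_self[of U "2 ^ i"], of "2 ^ b"]
    by (simp add: scan_def env_def pat_def m_def)
  show ?thesis unfolding letters_com_def
  proof (rule wp_blockI[OF ini], unfold prod.case, elim conjE)
    fix t :: nat and R1 :: "reg \<Rightarrow> nat" and M1
    assume M: "M1 = M" and R1: "t \<le> 4" "\<forall>r. r \<notin> {11, 20, 22} \<longrightarrow> R1 r = R r"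
      "R1 11 = 0" "R1 20 = U - 2 ^ i" "R1 22 = v ! i"
    \<comment> \<open>With \<open>g = i\<close> only the second alternative of \<open>scan\<close>
      remains, and the interval is \<open>{i..i}\<close>.\<close>
    have "U = 2 ^ i" if "g = i"
    proof -
      have "set_decode U = {i}" using scan i that by (auto simp: scan_def)
      then show ?thesis using set_decode_inverse[of U] set_encode_insert[of "{}" i] by simp
    qed
    then have at: "at_position U i g R1"
      using scan i R1 by (simp add: scan_def at_position_def)
    have env1: "env R1" using assms(1) R1 by (simp add: env_def)
    have mv1: "match_values U R1" using mv R1 by (simp add: match_values_def)
    let ?I = "\<lambda>x R' M'. pat M' \<and> filled U i x M' \<and> R' 11 = x \<and>
      (\<forall>r. r \<notin> {11, 12, 13, 16, 17, 18, 19} \<longrightarrow> R' r = R1 r)"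
    have loop: "wp b m (WhileLess 11 2 entry_com)
      (\<lambda>t (R', M'). t \<le> (a - 0) * (100 + 1) + 1 \<and> ?I a R' M') (R1, M)"
    proof (rule wp_WhileLess[where I = ?I])
      show "?I 0 R1 M" using assms(2,3) R1 by simp
      fix x R' M' assume "x < a" and I: "?I x R' M'"
      have "env R'" "at_position U i g R'" "match_values U R'"
        using I env1 at mv1 by (simp_all add: env_def at_position_def match_values_def)
      then have "wp b m entry_com (\<lambda>t (R'', M''). t \<le> 100 \<and> pat M'' \<and> filled U i (Suc x) M'' \<and>
          R'' 11 = Suc x \<and> (\<forall>r. r \<notin> {11, 12, 13, 16, 17, 18, 19} \<longrightarrow> R'' r = R' r)) (R', M')"
        using I \<open>x < a\<close> by (intro wp_entry) auto
      moreover have "R' 11 < R' 2" using I \<open>x < a\<close> env1 by (simp add: env_def)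
      ultimately show "R' 11 < R' 2 \<and> wp b m entry_com
          (\<lambda>t (R'', M''). t \<le> 100 \<and> ?I (Suc x) R'' M'') (R', M')"
        using I by (auto elim!: wp_mono)
    next
      fix R' M' assume "?I a R' M'"
      then show "\<not> R' 11 < R' 2" using env1 by (simp add: env_def)
    qed simp
    show "wp b m (block [WhileLess 11 2 entry_com, block [copy 10 8, copy 21 9]])
      (\<lambda>t2 (R', M'). t + t2 \<le> a * 101 + 10 \<and> pat M' \<and> filled U i a M' \<and> R' 10 = i \<and> R' 21 = 2 ^ i \<and>
         (\<forall>r. r \<notin> {10, 11, 12, 13, 16, 17, 18, 19, 20, 21, 22} \<longrightarrow> R' r = R r)) (R1, M1)"
      unfolding M
    proof (rule wp_blockI[OF loop], unfold prod.case, elim conjE)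
      fix t' :: nat and R2 :: "reg \<Rightarrow> nat" and M2
      assume R2: "t' \<le> (a - 0) * (100 + 1) + 1" "pat M2" "filled U i a M2"
        "\<forall>r. r \<notin> {11, 12, 13, 16, 17, 18, 19} \<longrightarrow> R2 r = R1 r"
      have "R2 8 = i" "R2 9 = 2 ^ i" "R2 14 = 0"
        using R1 R2 scan assms(1) by (simp_all add: scan_def env_def)
      then show "wp b m (block [block [copy 10 8, copy 21 9]])
        (\<lambda>t2 (R', M'). t + (t' + t2) \<le> a * 101 + 10 \<and> pat M' \<and> filled U i a M' \<and> R' 10 = i \<and> R' 21 = 2 ^ i \<and>
         (\<forall>r. r \<notin> {10, 11, 12, 13, 16, 17, 18, 19, 20, 21, 22} \<longrightarrow> R' r = R r)) (R2, M2)"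
        using R1 R2 b \<open>i < n\<close> \<open>i < b\<close> by simp
    qed
  qed
qed

lemma wp_position:
  assumes "env R" "pat M" "filled U i 0 M" and scan: "scan U i g R" and i: "i < n"
    and mv: "match_values U R"
  shows "wp b m position_com
      (\<lambda>t (R', M'). t \<le> a * 101 + 30 \<and> env R' \<and> pat M' \<and> filled U (Suc i) 0 M' \<and>
         (\<exists>g'. scan U (Suc i) g' R') \<and> match_values U R' \<and> R' 6 = R 6 \<and> R' 7 = R 7) (R, M)"
proof -
  note b = m_less[unfolded m_def] tsize_ge
  \<comment> \<open>Register 9 is doubled even after the last position, so \<open>2 ^ n\<close> has
    to fit into a word.\<close>
  have pow: "2 * 2 ^ i < (2::nat) ^ b"
  proof -
    have "2 ^ i < (2::nat) ^ n" using i by simp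
    with b show ?thesis by linarith
  qed
  have "U div 2 ^ i < 2 ^ b"
    using scan b by (intro le_less_trans[OF div_le_dividend]) (auto simp: scan_def)
  then have ini: "wp b m (block [Arith Div 18 5 9, Arith Mod 18 18 15])
      (\<lambda>t (R', M'). t \<le> 3 \<and> M' = M \<and> (\<forall>r. r \<notin> {18} \<longrightarrow> R' r = R r) \<and>
        R' 18 = U div 2 ^ i mod 2) (R, M)"
    using assms(1) scan b by (simp add: scan_def env_def)
  show ?thesis unfolding position_com_def
  proof (rule wp_blockI[OF ini], unfold prod.case, elim conjE)
    fix t :: nat and R1 :: "reg \<Rightarrow> nat" and M1
    assume M: "M1 = M" and R1: "t \<le> 3" "\<forall>r. r \<notin> {18} \<longrightarrow> R1 r = R r" "R1 18 = U div 2 ^ i mod 2"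
    have env1: "env R1" and mv1: "match_values U R1" and scan1: "scan U i g R1"
      using assms R1 by (simp_all add: env_def match_values_def scan_def)
    let ?X = "{10, 11, 12, 13, 16, 17, 18, 19, 20, 21, 22} :: nat set"
    let ?Q = "\<lambda>t (R', M'). t \<le> a * 101 + 12 \<and> pat M' \<and> filled U (Suc i) 0 M' \<and>
         (\<exists>g'. g' \<in> set_decode U \<and> (g' < Suc i \<or> set_decode U \<subseteq> {Suc i..g'}) \<and>
           R' 10 = g' \<and> R' 21 = 2 ^ g') \<and>
         (\<forall>r. r \<notin> ?X \<longrightarrow> R' r = R1 r)"
    have branch: "wp b m (IfLess 14 18 letters_com Skip) ?Q (R1, M)"
    proof (cases "i \<in> set_decode U")
      case True
      then have "R1 14 < R1 18" using R1 env1 by (simp add: set_decode_def env_def odd_iff_mod_2_eq_one)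
      then show ?thesis
        unfolding wp_IfLess if_P[OF \<open>R1 14 < R1 18\<close>]
        by (intro wp_mono[OF wp_letters[OF env1 assms(2,3) scan1 True mv1]])
          (use True in \<open>auto intro: filled_next_position\<close>)
    next
      case False
      then have *: "\<not> R1 14 < R1 18" using R1 env1 by (simp add: set_decode_def env_def even_iff_mod_2_eq_zero)
      \<comment> \<open>As \<open>i\<close> is not in the set, the lower end of the interval can
        move past it.\<close>
      have "g < Suc i \<or> set_decode U \<subseteq> {Suc i..g}"
      proof (cases "g < i")
        case 2: False
        then have "set_decode U \<subseteq> {i..g} - {i}" using scan False by (auto simp: scan_def)
        also have "\<dots> = {Suc i..g}" by auto
        finally show ?thesis ..
      qed simp
      then show ?thesis
        unfolding wp_IfLess if_not_P[OF *]
        using scan1 assms(2) filled_skip_position[OF assms(3) False]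
        by (simp add: scan_def)
    qed
    show "wp b m (block [IfLess 14 18 letters_com Skip, block [Arith Add 8 8 3, Arith Add 9 9 9]])
      (\<lambda>t2 (R', M'). t + t2 \<le> a * 101 + 30 \<and> env R' \<and> pat M' \<and> filled U (Suc i) 0 M' \<and>
         (\<exists>g'. scan U (Suc i) g' R') \<and> match_values U R' \<and> R' 6 = R 6 \<and> R' 7 = R 7) (R1, M1)"
      unfolding M
    proof (rule wp_blockI[OF branch], unfold prod.case, elim conjE)
      fix t' :: nat and R2 :: "reg \<Rightarrow> nat" and M2
      assume R2: "t' \<le> a * 101 + 12" "pat M2" "filled U (Suc i) 0 M2"
        "\<exists>g'. g' \<in> set_decode U \<and> (g' < Suc i \<or> set_decode U \<subseteq> {Suc i..g'}) \<and>
           R2 10 = g' \<and> R2 21 = 2 ^ g'"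
        "\<forall>r. r \<notin> ?X \<longrightarrow> R2 r = R1 r"
      have keep: "R2 8 = i" "R2 9 = 2 ^ i" "R2 5 = U" "U < 2 ^ n" "env R2" "match_values U R2"
         "R2 3 = 1" "R2 6 = R 6" "R2 7 = R 7"
        using R1 R2 scan env1 mv1 by (simp_all add: scan_def env_def match_values_def)
      show "wp b m (block [block [Arith Add 8 8 3, Arith Add 9 9 9]])
       (\<lambda>t2 (R', M'). t + (t' + t2) \<le> a * 101 + 30 \<and> env R' \<and> pat M' \<and> filled U (Suc i) 0 M' \<and>
         (\<exists>g'. scan U (Suc i) g' R') \<and> match_values U R' \<and> R' 6 = R 6 \<and> R' 7 = R 7) (R2, M2)"
        using R1 R2 keep b pow i by (simp add: env_def match_values_def scan_def)
    qed
  qed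
qed

section \<open>Shift and successor for the matching letter\<close>

lemma match_values_partial:
  assumes "Suc U < 2 ^ n" "R 23 = 0" "R 24 = U"
  shows "match_values U R"
  unfolding match_values_def
proof
  fix i assume i: "i \<in> set_decode U"
  have sub: "set_decode U \<subseteq> {..<n}" using assms(1) by (intro set_decode_subset) simp
  \<comment> \<open>Equality would make the union full, with mask \<open>2 ^ n - 1\<close>, against
    \<open>Suc U < 2 ^ n\<close>.\<close>
  have "card (set_decode U - {i}) \<noteq> n - 1"
  proof
    assume "card (set_decode U - {i}) = n - 1"
    moreover have "card (set_decode U) = Suc (card (set_decode U - {i}))"
      using i by (metis card_Suc_Diff1 finite_set_decode)
    ultimately have "card (set_decode U) = n" using n_pos by linarith
    then have "set_decode U = {..<n}" using sub by (intro card_subset_eq) auto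
    then have "U = 2 ^ n - 1" using set_decode_inverse[of U] set_encode_lessThan[of n] by simp
    with assms(1) show False by simp
  qed
  then have "lattice_shift v (set_decode U - {i}) i (v ! i) = 0"
    by (intro lattice_shift_0) auto
  with i assms show "lattice_shift v (set_decode U - {i}) i (v ! i) = R 23 \<and>
     set_encode (lattice_next v (set_decode U - {i}) i (v ! i)) = R 24"
    by (simp add: lattice_next_def insert_absorb)
qed

text \<open>With all letters of \<open>v\<close> known and start 1, the least fit is the least
  period of \<open>v\<close>.\<close>

lemma match_values_full:
  assumes "tracks (letters_at v {..<n}) 1 R" "R' 23 = R 12" "R' 24 = R 13"
  shows "match_values (2 ^ n - 1) R'"
proof -
  have u: "set_decode (2 ^ n - 1) = {..<n}"
    using set_encode_inverse[of "{..<n}"] by (simp add: set_encode_lessThan)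
  have *: "lattice_shift v ({..<n} - {i}) i (v ! i) = R 12" if "i < n" for i
  proof (rule lattice_shift_eqI)
    have "(letters_at v ({..<n} - {i}))(i \<mapsto> v ! i) = letters_at v {..<n}"
      using that by (simp flip: letters_at_insert add: insert_absorb)
    then show "first_fit v ((letters_at v ({..<n} - {i}))(i \<mapsto> v ! i))
       (if card ({..<n} - {i}) = n - 1 then 1 else 0) (R 12)"
      using that assms(1) by (simp add: tracks_def)
  qed simp
  show ?thesis
    unfolding match_values_def u
  proof
    fix i assume "i \<in> {..<n}"
    with assms * show "lattice_shift v ({..<n} - {i}) i (v ! i) = R' 23 \<and>
         set_encode (lattice_next v ({..<n} - {i}) i (v ! i)) = R' 24"
      by (simp add: lattice_next_def tracks_def insert_absorb)
  qed
qed

lemma wp_period: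
  assumes "env R" "pat M" "filled (2 ^ n - 1) 0 0 M"
  shows "wp b m period_com
      (\<lambda>t (R', M'). t \<le> n * 31 + 10 \<and> M' = M \<and> match_values (2 ^ n - 1) R' \<and>
         (\<forall>r. r \<notin> {12, 13, 16, 17, 18, 19, 23, 24} \<longrightarrow> R' r = R r)) (R, M)"
proof -
  note b = m_less[unfolded m_def] tsize_ge
  have ini: "wp b m (block [Const 12 1, Const 13 0, Const 16 1])
      (\<lambda>t (R', M'). t \<le> 4 \<and> M' = M \<and> (\<forall>r. r \<notin> {12, 13, 16} \<longrightarrow> R' r = R r) \<and>
        R' 12 = 1 \<and> R' 13 = 0 \<and> R' 16 = 1) (R, M)"
    using b by simp
  show ?thesis unfolding period_com_def
  proof (rule wp_blockI[OF ini], unfold prod.case, elim conjE)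
    fix t :: nat and R1 :: "reg \<Rightarrow> nat" and M1
    assume M: "M1 = M" and R1: "t \<le> 4" "\<forall>r. r \<notin> {12, 13, 16} \<longrightarrow> R1 r = R r"
      "R1 12 = 1" "R1 13 = 0" "R1 16 = 1"
    let ?I = "\<lambda>j R' M'. j \<le> n \<and> M' = M \<and> R' 16 = j \<and> tracks (letters_at v {..<j}) 1 R' \<and>
      (\<forall>r. r \<notin> {12, 13, 16, 17, 18, 19} \<longrightarrow> R' r = R r)"
    have loop: "wp b m (WhileLess 16 0 (block [Load 17 16, step_com, Arith Add 16 16 3]))
      (\<lambda>t (R', M'). t \<le> (n - 1) * (30 + 1) + 1 \<and> ?I n R' M') (R1, M)"
    proof (rule wp_WhileLess[where I = ?I])
      show "1 \<le> n" using n_pos by linarith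
      \<comment> \<open>The loop index starts at 1: position 0 counts as read, since shift 1 removes
        it.\<close>
      have "{..<1} \<ominus> 1 = ({} :: nat set)" by (auto simp: mem_ominus)
      moreover have "first_fit v (letters_at v {..<1}) 1 1"
        by (auto simp: first_fit_def agrees_def letters_at_def)
      ultimately show "?I 1 R1 M" using R1 Suc_leI[OF n_pos] by (auto simp: tracks_def)
      fix j R' M' assume "j < n" and I: "?I j R' M'"
      let ?R = "R'(17 := v ! j)"
      have env': "env ?R" using I assms(1) by (simp add: env_def)
      have tr: "tracks (letters_at v {..<j}) 1 ?R" using I by (simp add: tracks_def)
      then have "0 < ?R 12" by (simp add: tracks_def first_fit_def)
      \<comment> \<open>The shift is positive, so the lookup stays below the mask of the full
        set.\<close>
      then have "set_encode (insert j {..<j} \<ominus> ?R 12) < set_encode {..<n}"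
        using \<open>j < n\<close> by (intro set_encode_ominus_less) auto
      then have step: "wp b m step_com (\<lambda>t (R'', M''). t \<le> 20 \<and> M'' = M \<and>
          (\<forall>r. r \<notin> {12, 13, 18, 19} \<longrightarrow> R'' r = ?R r) \<and>
          tracks ((letters_at v {..<j})(?R 16 \<mapsto> ?R 17)) 1 R'') (?R, M)"
        using I \<open>j < n\<close> letter_less[of j] n_pos
        by (intro wp_step[OF env' assms(3) _ tr]) (auto simp: set_encode_lessThan)
      have j: "R' 16 < m" "M (R' 16) = v ! j"
        using I \<open>j < n\<close> assms(2) by (auto simp: m_def pat_def)
      have "wp b m (block [Load 17 16, step_com, Arith Add 16 16 3])
          (\<lambda>t (R'', M''). t \<le> 30 \<and> ?I (Suc j) R'' M'') (R', M)"
        unfolding block.simps wp_Seq wp_Load j(2)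
      proof (intro conjI j(1) wp_mono[OF step], unfold prod.case, elim conjE)
        fix t :: nat and R2 :: "reg \<Rightarrow> nat" and M2
        assume M: "M2 = M" and R2: "t \<le> 20" "\<forall>r. r \<notin> {12, 13, 18, 19} \<longrightarrow> R2 r = ?R r"
          "tracks ((letters_at v {..<j})(?R 16 \<mapsto> ?R 17)) 1 R2"
        have "R2 16 = j" "R2 3 = 1" using I R2 assms(1) by (simp_all add: env_def)
        moreover have "tracks (letters_at v {..<Suc j}) 1 R2"
          using I R2 by (simp add: lessThan_Suc letters_at_insert)
        then have "tracks (letters_at v {..<Suc j}) 1 (R2(16 := Suc j))"
          by (simp add: tracks_def)
        ultimately show "wp b m (Arith Add 16 16 3) (\<lambda>t2. wp b m Skip
            (\<lambda>t3 (R'', M''). 1 + (t + (t2 + t3)) \<le> 30 \<and> ?I (Suc j) R'' M'')) (R2, M2)"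
          using M I R2 b \<open>j < n\<close> by simp
      qed
      then show "R' 16 < R' 0 \<and> wp b m (block [Load 17 16, step_com, Arith Add 16 16 3])
          (\<lambda>t (R'', M''). t \<le> 30 \<and> ?I (Suc j) R'' M'') (R', M')"
        using I \<open>j < n\<close> assms(1) by (simp add: env_def)
    next
      fix R' M' assume "?I n R' M'"
      then show "\<not> R' 16 < R' 0" using assms(1) by (simp add: env_def)
    qed
    show "wp b m (block [WhileLess 16 0 (block [Load 17 16, step_com, Arith Add 16 16 3]),
          block [copy 23 12, copy 24 13]])
      (\<lambda>t2 (R', M'). t + t2 \<le> n * 31 + 10 \<and> M' = M \<and> match_values (2 ^ n - 1) R' \<and>
         (\<forall>r. r \<notin> {12, 13, 16, 17, 18, 19, 23, 24} \<longrightarrow> R' r = R r)) (R1, M1)"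
      unfolding M
    proof (rule wp_blockI[OF loop], unfold prod.case, elim conjE)
      fix t' :: nat and R2 :: "reg \<Rightarrow> nat" and M2
      assume R2: "t' \<le> (n - 1) * (30 + 1) + 1" "M2 = M" "tracks (letters_at v {..<n}) 1 R2"
        "\<forall>r. r \<notin> {12, 13, 16, 17, 18, 19} \<longrightarrow> R2 r = R r"
      have "first_fit v (letters_at v {..<n}) 1 (R2 12)" using R2(3) by (simp add: tracks_def)
      then have "R2 12 \<le> n"
        by (rule first_fit_le_length) (use Suc_leI[OF n_pos] in simp_all)
      moreover have "R2 13 < 2 ^ n"
        using R2(3) by (auto simp: tracks_def intro!: set_encode_less ominus_subset)
      moreover have "t' \<le> n * 31"
        using R2(1) Suc_leI[OF n_pos] by (simp add: diff_mult_distrib)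
      moreover note match_values_full[OF R2(3), of "R2(23 := R2 12, 24 := R2 13)"]
      ultimately show "wp b m (block [block [copy 23 12, copy 24 13]])
        (\<lambda>t2 (R', M'). t + (t' + t2) \<le> n * 31 + 10 \<and> M' = M \<and> match_values (2 ^ n - 1) R' \<and>
         (\<forall>r. r \<notin> {12, 13, 16, 17, 18, 19, 23, 24} \<longrightarrow> R' r = R r)) (R2, M2)"
        using R1 R2 b assms(1) by (simp add: env_def)
    qed
  qed
qed

lemma wp_match:
  assumes "env R" "pat M" "filled U 0 0 M" "R 5 = U" "U < 2 ^ n"
  shows "wp b m match_com
      (\<lambda>t (R', M'). t \<le> n * 31 + 15 \<and> M' = M \<and> match_values U R' \<and>
         (\<forall>r. r \<notin> {12, 13, 16, 17, 18, 19, 23, 24} \<longrightarrow> R' r = R r)) (R, M)"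
proof -
  note b = m_less[unfolded m_def] tsize_ge
  let ?R = "R(18 := Suc U)"
  have env': "env ?R" using assms(1) by (simp add: env_def)
  show ?thesis
  proof (cases "Suc U < 2 ^ n")
    case True
    then show ?thesis
      using assms b match_values_partial[OF True, of "?R(23 := 0, 24 := U)"]
      by (simp add: match_com_def env_def)
  next
    case False
    then have U: "U = 2 ^ n - 1" using assms(5) by simp
    have "wp b m period_com
      (\<lambda>t (R', M'). t \<le> n * 31 + 10 \<and> M' = M \<and> match_values (2 ^ n - 1) R' \<and>
         (\<forall>r. r \<notin> {12, 13, 16, 17, 18, 19, 23, 24} \<longrightarrow> R' r = ?R r)) (?R, M)"
      by (rule wp_period[OF env' assms(2) assms(3)[unfolded U]])
    then have "wp b m period_com
      (\<lambda>t (R', M'). t + 3 \<le> n * 31 + 15 \<and> M' = M \<and> match_values U R' \<and>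
         (\<forall>r. r \<notin> {12, 13, 16, 17, 18, 19, 23, 24} \<longrightarrow> R' r = R r)) (?R, M)"
      by (rule wp_mono) (auto simp: U)
    then show ?thesis
      using assms b False by (simp add: match_com_def env_def) (elim wp_mono, auto)
  qed
qed

section \<open>The loop over sets and the whole program\<close>

definition at_set :: "nat \<Rightarrow> (reg \<Rightarrow> nat) \<Rightarrow> (nat \<Rightarrow> nat) \<Rightarrow> bool" where
  "at_set U R M \<longleftrightarrow> env R \<and> pat M \<and> filled U 0 0 M \<and> R 5 = U \<and>
     (\<exists>h. R 6 = h \<and> R 7 = 2 ^ h \<and> 2 ^ h \<le> U \<and> U \<le> 2 * 2 ^ h)"

lemma wp_set:
  assumes at: "at_set U R M" and U: "U < 2 ^ n"
  shows "wp b m set_com (\<lambda>t (R', M'). t \<le> n * (a * 101 + 62) + 60 \<and> at_set (Suc U) R' M') (R, M)"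
proof -
  note b = m_less[unfolded m_def] tsize_ge
  have env: "env R" and pat: "pat M" and fil: "filled U 0 0 M" and R5: "R 5 = U"
    using at by (simp_all add: at_set_def)
  obtain h where h: "R 6 = h" "R 7 = 2 ^ h" "2 ^ h \<le> U" "U \<le> 2 * 2 ^ h"
    using at by (auto simp: at_set_def)
  \<comment> \<open>Register 6 lags behind when \<open>U\<close> has just become
    \<open>2 * 2 ^ h\<close>, which is why \<open>at_set\<close> has a non-strict upper bound;
    \<open>k\<close> is the corrected top position.\<close>
  define k where "k = (if U < 2 * 2 ^ h then h else Suc h)"
  have k: "2 ^ k \<le> U" "U < 2 * 2 ^ k"
    using h U by (auto simp: k_def)
  have kb: "k \<le> n" "k < b"
  proof -
    have "2 ^ k < (2::nat) ^ n" "2 ^ k < (2::nat) ^ b" using k U b by linarith+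
    then show "k \<le> n" "k < b" by simp_all
  qed
  have "2 * 2 ^ h < (2::nat) ^ b" "Suc h < 2 ^ b"
    using h U b less_exp[of h] by linarith+
  then have 1: "wp b m (block [Arith Add 18 7 7, IfLess 5 18 Skip (block [copy 7 18, Arith Add 6 6 3])])
      (\<lambda>t (R', M'). t \<le> 10 \<and> M' = M \<and> R' 6 = k \<and> R' 7 = 2 ^ k \<and>
         (\<forall>r. r \<notin> {6, 7, 18} \<longrightarrow> R' r = R r)) (R, M)"
    using env h R5 kb b by (simp add: env_def k_def)
  show ?thesis unfolding set_com_def
  proof (rule wp_blockI[OF 1], unfold prod.case, elim conjE)
    fix t1 :: nat and R1 :: "reg \<Rightarrow> nat" and M1
    assume M: "M1 = M" and R1: "t1 \<le> 10" "R1 6 = k" "R1 7 = 2 ^ k"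
       "\<forall>r. r \<notin> {6, 7, 18} \<longrightarrow> R1 r = R r"
    have "env R1" "R1 5 = U" using env R1 R5 by (simp_all add: env_def)
    note 2 = wp_match[OF this(1) pat fil this(2) U]
    show "wp b m (block [match_com, block [copy 10 6, copy 21 7, Const 8 0, Const 9 1],
        WhileLess 8 0 position_com, Arith Add 5 5 3])
      (\<lambda>t (R', M'). t1 + t \<le> n * (a * 101 + 62) + 60 \<and> at_set (Suc U) R' M') (R1, M1)"
      unfolding M
    proof (rule wp_blockI[OF 2], unfold prod.case, elim conjE)
      fix t2 :: nat and R2 :: "reg \<Rightarrow> nat" and M2
      assume M: "M2 = M" and R2: "t2 \<le> n * 31 + 15" "match_values U R2"
        "\<forall>r. r \<notin> {12, 13, 16, 17, 18, 19, 23, 24} \<longrightarrow> R2 r = R1 r"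
      have 3: "wp b m (block [copy 10 6, copy 21 7, Const 8 0, Const 9 1])
        (\<lambda>t (R', M'). t \<le> 5 \<and> M' = M \<and> R' 10 = k \<and> R' 21 = 2 ^ k \<and> R' 8 = 0 \<and> R' 9 = 1 \<and>
           (\<forall>r. r \<notin> {8, 9, 10, 21} \<longrightarrow> R' r = R2 r)) (R2, M)"
        using R1 R2 env b kb by (simp add: env_def)
      show "wp b m (block [block [copy 10 6, copy 21 7, Const 8 0, Const 9 1],
          WhileLess 8 0 position_com, Arith Add 5 5 3])
        (\<lambda>t (R', M'). t1 + (t2 + t) \<le> n * (a * 101 + 62) + 60 \<and> at_set (Suc U) R' M') (R2, M2)"
        unfolding M
      proof (rule wp_blockI[OF 3], unfold prod.case, elim conjE)
        fix t3 :: nat and R3 :: "reg \<Rightarrow> nat" and M3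
        assume M: "M3 = M" and R3: "t3 \<le> 5" "R3 10 = k" "R3 21 = 2 ^ k" "R3 8 = 0" "R3 9 = 1"
           "\<forall>r. r \<notin> {8, 9, 10, 21} \<longrightarrow> R3 r = R2 r"
        have "k \<in> set_decode U"
        proof -
          have "U div 2 ^ k = 1" using k by (intro div_nat_eqI) auto
          then show ?thesis by (simp add: set_decode_def)
        qed
        moreover have "set_decode U \<subseteq> {0..k}"
          using set_decode_subset[of U "Suc k"] k by auto
        ultimately have scan: "scan U 0 k R3"
          using R1 R2 R3 R5 U by (simp add: scan_def)
        let ?I = "\<lambda>i R' M'. env R' \<and> pat M' \<and> filled U i 0 M' \<and> (\<exists>g. scan U i g R') \<and>
            match_values U R' \<and> R' 6 = k \<and> R' 7 = 2 ^ k"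
        have 4: "wp b m (WhileLess 8 0 position_com)
          (\<lambda>t (R', M'). t \<le> (n - 0) * (a * 101 + 30 + 1) + 1 \<and> ?I n R' M') (R3, M)"
        proof (rule wp_WhileLess[where I = ?I])
          show "?I 0 R3 M"
            using R1 R2 R3 env pat fil scan by (auto simp: env_def match_values_def)
          fix i R' M' assume "i < n" and I: "?I i R' M'"
          then obtain g where g: "scan U i g R'" by auto
          with I \<open>i < n\<close> have "R' 8 < R' 0" by (simp add: env_def scan_def)
          moreover have "wp b m position_com (\<lambda>t (R'', M''). t \<le> a * 101 + 30 \<and> ?I (Suc i) R'' M'') (R', M')"
            by (rule wp_mono[OF wp_position[OF _ _ _ g \<open>i < n\<close>]]) (use I in auto)
          ultimately show "R' 8 < R' 0 \<and> wp b m position_com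
             (\<lambda>t (R'', M''). t \<le> a * 101 + 30 \<and> ?I (Suc i) R'' M'') (R', M')" by blast
        next
          fix R' M' assume "?I n R' M'"
          then show "\<not> R' 8 < R' 0" by (auto simp: env_def scan_def)
        qed simp
        show "wp b m (block [WhileLess 8 0 position_com, Arith Add 5 5 3])
          (\<lambda>t (R', M'). t1 + (t2 + (t3 + t)) \<le> n * (a * 101 + 62) + 60 \<and> at_set (Suc U) R' M') (R3, M3)"
          unfolding M
        proof (rule wp_blockI[OF 4], unfold prod.case, elim conjE)
          fix t4 :: nat and R4 :: "reg \<Rightarrow> nat" and M4
          assume R4: "t4 \<le> (n - 0) * (a * 101 + 30 + 1) + 1" "env R4" "pat M4" "filled U n 0 M4"
            "\<exists>g. scan U n g R4" "R4 6 = k" "R4 7 = 2 ^ k"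
          have "R4 5 = U" "R4 3 = 1" using R4 by (auto simp: scan_def env_def)
          \<comment> \<open>Per position, 31 units pay for the possible period computation and
            \<open>a * 101 + 31\<close> for the scan.\<close>
          moreover have "t1 + (t2 + (t3 + (t4 + 2))) \<le> n * (a * 101 + 62) + 60"
            using R1(1) R2(1) R3(1) R4(1) by (simp add: algebra_simps)
          ultimately show "wp b m (block [Arith Add 5 5 3])
            (\<lambda>t (R', M'). t1 + (t2 + (t3 + (t4 + t))) \<le> n * (a * 101 + 62) + 60 \<and> at_set (Suc U) R' M') (R4, M4)"
            using R4 filled_next_set[of U M4] U b k by (simp add: at_set_def env_def)
        qed
      qed
    qed
  qed
qed

lemma wp_lattice:
  assumes "R 0 = n" "\<And>r. r \<noteq> 0 \<Longrightarrow> R r = 0" "pat M"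
  shows "wp b m (lattice_com a)
    (\<lambda>t (R', M'). t \<le> 2 ^ n * (n * (a * 101 + 62) + 61) + n * 10 + 30 \<and> at_set (2 ^ n) R' M') (R, M)"
proof -
  note b = m_less[unfolded m_def] tsize_ge
  have 1: "wp b m (block [Const 2 a, Const 3 1, Const 15 2, Const 4 1])
    (\<lambda>t (R', M'). t \<le> 5 \<and> M' = M \<and> R' = R(2 := a, 3 := 1, 15 := 2, 4 := 1)) (R, M)"
    using b by simp
  show ?thesis unfolding lattice_com_def
  proof (rule wp_blockI[OF 1], unfold prod.case, elim conjE)
    fix t1 :: nat and R1 :: "reg \<Rightarrow> nat" and M1
    assume M: "M1 = M" and t1: "t1 \<le> 5" and "R1 = R(2 := a, 3 := 1, 15 := 2, 4 := 1)"
    then have R1: "R1 0 = n" "R1 2 = a" "R1 3 = 1" "R1 15 = 2" "R1 4 = 1" "R1 14 = 0"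
      "R1 6 = 0" "R1 8 = 0"
      using assms by simp_all
    let ?I = "\<lambda>i R' M'. i \<le> n \<and> M' = M \<and> R' 8 = i \<and> R' 4 = 2 ^ i \<and>
       (\<forall>r. r \<notin> {4, 8} \<longrightarrow> R' r = R1 r)"
    have 2: "wp b m (WhileLess 8 0 (block [Arith Add 4 4 4, Arith Add 8 8 3]))
      (\<lambda>t (R', M'). t \<le> (n - 0) * (5 + 1) + 1 \<and> ?I n R' M') (R1, M)"
    proof (rule wp_WhileLess[where I = ?I])
      show "?I 0 R1 M" using R1 by simp
      fix i R' M' assume "i < n" and I: "?I i R' M'"
      have "2 * 2 ^ i \<le> (2::nat) ^ n"
        using \<open>i < n\<close> power_increasing[of "Suc i" n "2::nat"] by simp
      then have "2 * 2 ^ i < (2::nat) ^ b" using b by linarith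
      then show "R' 8 < R' 0 \<and> wp b m (block [Arith Add 4 4 4, Arith Add 8 8 3])
          (\<lambda>t (R'', M''). t \<le> 5 \<and> ?I (Suc i) R'' M'') (R', M')"
        using I R1 \<open>i < n\<close> b by simp
    qed (use R1 in auto)
    show "wp b m (block [WhileLess 8 0 (block [Arith Add 4 4 4, Arith Add 8 8 3]),
      block [Arith Mul 1 0 4, Arith Mul 1 1 2, Arith Add 1 1 0, Const 5 1, Const 7 1],
      WhileLess 5 4 set_com])
      (\<lambda>t (R', M'). t1 + t \<le> 2 ^ n * (n * (a * 101 + 62) + 61) + n * 10 + 30 \<and> at_set (2 ^ n) R' M') (R1, M1)"
      unfolding M
    proof (rule wp_blockI[OF 2], unfold prod.case, elim conjE)
      fix t2 :: nat and R2 :: "reg \<Rightarrow> nat" and M2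
      assume M: "M2 = M" and R2: "t2 \<le> (n - 0) * (5 + 1) + 1" "R2 4 = 2 ^ n"
         "\<forall>r. r \<notin> {4, 8} \<longrightarrow> R2 r = R1 r"
      \<comment> \<open>Each union contains \<open>i\<close> and so has a nonzero mask: nothing
        precedes \<open>U = 1\<close>.\<close>
      have "filled 1 0 0 M"
      proof -
        have "set_encode (insert i s) \<noteq> 0" if "key s i x" for s i x
        proof -
          have "finite s" using that by (auto simp: key_def intro: finite_subset)
          then show ?thesis using set_encode_strict_mono[of "{}" "insert i s"] by auto
        qed
        then show ?thesis unfolding filled_def by (metis less_one not_less0)
      qed
      \<comment> \<open>The top position of mask 1 is 0, the value that register 6 still
        has.\<close>
      then have 3: "wp b m (block [Arith Mul 1 0 4, Arith Mul 1 1 2, Arith Add 1 1 0, Const 5 1, Const 7 1])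
        (\<lambda>t (R', M'). t \<le> 6 \<and> at_set 1 R' M') (R2, M)"
        using R1 R2 b assms(3) tsize_def[symmetric]
        by (simp add: at_set_def env_def)
      show "wp b m (block [block [Arith Mul 1 0 4, Arith Mul 1 1 2, Arith Add 1 1 0, Const 5 1, Const 7 1],
          WhileLess 5 4 set_com])
        (\<lambda>t (R', M'). t1 + (t2 + t) \<le> 2 ^ n * (n * (a * 101 + 62) + 61) + n * 10 + 30 \<and> at_set (2 ^ n) R' M')
        (R2, M2)"
        unfolding M
      proof (rule wp_blockI[OF 3], unfold prod.case, elim conjE)
        fix t3 :: nat and R3 :: "reg \<Rightarrow> nat" and M3
        assume R3: "t3 \<le> 6" "at_set 1 R3 M3"
        let ?C = "n * (a * 101 + 62) + 60"
        have 4: "wp b m (WhileLess 5 4 set_com)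
          (\<lambda>t (R', M'). t \<le> (2 ^ n - 1) * (?C + 1) + 1 \<and> at_set (2 ^ n) R' M') (R3, M3)"
        proof (rule wp_WhileLess[where I = at_set])
          show "at_set 1 R3 M3" by fact
          fix U R' M' assume U: "U < 2 ^ n" and at: "at_set U R' M'"
          then show "R' 5 < R' 4 \<and> wp b m set_com (\<lambda>t (R'', M''). t \<le> ?C \<and> at_set (Suc U) R'' M'') (R', M')"
            using wp_set[OF at U] by (simp add: at_set_def env_def)
        next
          fix R' M' assume "at_set (2 ^ n) R' M'"
          then show "\<not> R' 5 < R' 4" by (simp add: at_set_def env_def)
        qed simp
        have le: "(2 ^ n - 1) * (?C + 1) + 1 \<le> 2 ^ n * (n * (a * 101 + 62) + 61) + 1"
          by (intro add_right_mono mult_mono) auto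
        have "t1 + (t2 + (t3 + (t4 + 1))) \<le> 2 ^ n * (n * (a * 101 + 62) + 61) + n * 10 + 30"
          if "t4 \<le> (2 ^ n - 1) * (?C + 1) + 1" for t4
          using order_trans[OF that le] t1 R2(1) R3(1) by simp
        then show "wp b m (block [WhileLess 5 4 set_com])
          (\<lambda>t (R', M'). t1 + (t2 + (t3 + t)) \<le> 2 ^ n * (n * (a * 101 + 62) + 61) + n * 10 + 30 \<and>
             at_set (2 ^ n) R' M') (R3, M3)"
          unfolding block.simps wp_Seq by (intro wp_mono[OF 4]) auto
      qed
    qed
  qed
qed

lemma at_set_final:
  assumes "at_set (2 ^ n) R M" "key s i x"
  shows "R 0 + idx s i x < m \<and> M (R 0 + idx s i x) = lattice_shift v s i x \<and>
    R 1 + idx s i x < m \<and> M (R 1 + idx s i x) = set_encode (lattice_next v s i x)"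
proof -
  have "set_encode (insert i s) < 2 ^ n"
    using assms(2) by (intro set_encode_less) (auto simp: key_def)
  with assms idx_less[OF assms(2)] show ?thesis
    by (auto simp: at_set_def env_def filled_def m_def)
qed

end

section \<open>Asymptotic bounds and the transfer to arbitrary letters\<close>

lemma bigo_nat:
  fixes f g :: "nat \<Rightarrow> nat"
  assumes "\<And>n. 1 \<le> n \<Longrightarrow> f n \<le> K * g n"
  shows "(\<lambda>n. real (f n)) \<in> O(\<lambda>n. real (g n))"
proof (rule bigoI)
  show "\<forall>\<^sub>F n in at_top. norm (real (f n)) \<le> real K * norm (real (g n))"
    \<comment> \<open>Small arguments must be discarded: \<open>n * 2 ^ n\<close> vanishes at 0,
      while the time bound does not.\<close>
    using eventually_ge_at_top[of "1::nat"]
    by eventually_elim (use assms of_nat_mono[where 'a = real] in \<open>fastforce simp flip: of_nat_mult\<close>)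
qed

theorem theorem2:
  fixes A :: "'a set" and enc :: "'a \<Rightarrow> nat"
  assumes "finite A" and "bij_betw enc A {0..<card A}"
  shows "\<exists>(P :: com) (time :: nat \<Rightarrow> nat) (space :: nat \<Rightarrow> nat) (wordlen :: nat \<Rightarrow> nat).
    (\<lambda>n. real (time n)) \<in> O(\<lambda>n. real n * 2 ^ n) \<and>
    (\<lambda>n. real (space n)) \<in> O(\<lambda>n. real n * 2 ^ n) \<and>
    (\<lambda>n. real (wordlen n)) \<in> O(\<lambda>n. real n) \<and>
    (\<forall>w \<in> lists A. w \<noteq> [] \<longrightarrow>
      ram_state (wordlen (length w)) (space (length w)) (input_state enc w) \<and>
      (\<exists>t \<sigma>. t \<le> time (length w) \<and>
        exec (wordlen (length w)) (space (length w)) P (input_state enc w) t \<sigma> \<and>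
        stores_position_lattice A enc w (space (length w)) \<sigma>))"
proof -
  define a where "a = card A"
  define time where "time n = 2 ^ n * (n * (a * 101 + 62) + 61) + n * 10 + 30" for n :: nat
  define space where "space n = n + 2 * (n * 2 ^ n * a)" for n :: nat
  \<comment> \<open>Here \<open>n * 2 ^ n * a\<close> is at most
    \<open>2 ^ n * 2 ^ n * 2 ^ a\<close>; the two extra bits absorb the second table and the
    pattern.\<close>
  define wordlen where "wordlen n = 2 * n + a + 2" for n :: nat
  have "(\<lambda>n. real (time n)) \<in> O(\<lambda>n. real (n * 2 ^ n))"
  proof (rule bigo_nat)
    fix n :: nat assume n: "1 \<le> n"
    have "1 * 2 ^ n \<le> n * 2 ^ n" "n * 1 \<le> n * 2 ^ n" "1 * 1 \<le> n * (2::nat) ^ n"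
      using n by (intro mult_mono; simp)+
    moreover have "time n = (a * 101 + 62) * (n * 2 ^ n) + 61 * 2 ^ n + 10 * n + 30"
      by (simp add: time_def algebra_simps)
    moreover have "(a * 101 + 163) * (n * 2 ^ n) = (a * 101 + 62) * (n * 2 ^ n) + 101 * (n * 2 ^ n)"
      by (simp add: algebra_simps)
    ultimately show "time n \<le> (a * 101 + 163) * (n * 2 ^ n)" by linarith
  qed
  moreover have "(\<lambda>n. real (space n)) \<in> O(\<lambda>n. real (n * 2 ^ n))"
  proof (rule bigo_nat)
    fix n :: nat
    show "space n \<le> (1 + 2 * a) * (n * 2 ^ n)" by (simp add: space_def algebra_simps)
  qed
  moreover have "(\<lambda>n. real (wordlen n)) \<in> O(\<lambda>n. real n)"
  proof (rule bigo_nat)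
    fix n :: nat assume "1 \<le> n"
    then have "a \<le> a * n" by simp
    moreover have "(a + 4) * n = a * n + 4 * n" by (simp add: algebra_simps)
    ultimately show "wordlen n \<le> (a + 4) * n" using \<open>1 \<le> n\<close> unfolding wordlen_def by linarith
  qed
  moreover have "ram_state (wordlen (length w)) (space (length w)) (input_state enc w) \<and>
      (\<exists>t \<sigma>. t \<le> time (length w) \<and>
        exec (wordlen (length w)) (space (length w)) (lattice_com a) (input_state enc w) t \<sigma> \<and>
        stores_position_lattice A enc w (space (length w)) \<sigma>)"
    if w: "w \<in> lists A" "w \<noteq> []" for w
  proof -
    let ?n = "length w"
    have inj: "inj_on enc A" and enc: "enc x < a" if "x \<in> A" for x
      using assms(2) that by (auto simp: bij_betw_def a_def)
    have wA: "w ! i \<in> A" if "i < ?n" for i using w that by auto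
    have fits: "space ?n < 2 ^ wordlen ?n"
    proof -
      have "?n < 2 ^ ?n" "a < 2 ^ a" by (rule less_exp)+
      then have "?n * 2 ^ ?n * a \<le> 2 ^ ?n * 2 ^ ?n * 2 ^ a" by (intro mult_mono) auto
      moreover have "?n < 2 ^ ?n * 2 ^ ?n * 2 ^ a"
        using \<open>?n < 2 ^ ?n\<close> by (rule less_le_trans) (simp add: mult.assoc)
      moreover have "(2::nat) ^ wordlen ?n = 4 * (2 ^ ?n * 2 ^ ?n * 2 ^ a)"
        by (simp add: wordlen_def power_add mult_2)
      ultimately show ?thesis unfolding space_def by linarith
    qed
    interpret pattern_ram "map enc w" a "wordlen ?n"
      using w fits enc wA by unfold_locales (auto simp: space_def)
    have m: "m = space ?n" by (simp add: m_def tsize_def space_def)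
    have "ram_state (wordlen ?n) (space ?n) (input_state enc w)"
      using fits letter_bound by (auto simp: ram_state_def input_state_def space_def)
    moreover have "wp (wordlen ?n) m (lattice_com a)
       (\<lambda>t (R', M'). t \<le> time ?n \<and> at_set (2 ^ ?n) R' M') (input_state enc w)"
      using wp_lattice[of "fst (input_state enc w)" "snd (input_state enc w)"]
      by (simp add: input_state_def pat_def time_def)
    then obtain t R M where run: "exec (wordlen ?n) (space ?n) (lattice_com a) (input_state enc w) t (R, M)"
       "t \<le> time ?n" "at_set (2 ^ ?n) R M"
      by (auto simp: wp_def m)
    have "stores_position_lattice A enc w (space ?n) (R, M)"
      unfolding stores_position_lattice_def Let_def
    proof (intro ballI)
      fix s i x assume s: "s \<in> lattice_states w" and i: "i \<in> {0..<?n} - s" and x: "x \<in> A"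
      have sub: "s \<subseteq> {..<?n}" using s by (auto simp: lattice_states_def)
      have key: "key s i (enc x)" using sub i enc[OF x] by (auto simp: key_def)
      \<comment> \<open>The program ran on the numbered pattern; injectivity of \<open>enc\<close>
        carries its values back to \<open>w\<close>.\<close>
      have shift: "lattice_shift (map enc w) s i (enc x) = lattice_shift w s i x"
        using w(1) x sub i by (intro lattice_shift_map[OF inj[OF x]]) auto
      then have "lattice_next (map enc w) s i (enc x) = lattice_next w s i x"
        by (simp add: lattice_next_def)
      moreover have "idx s i (enc x) = table_index A enc w s i x"
        by (simp add: idx_def table_index_def flip: a_def)
      ultimately show "fst (R, M) 0 + table_index A enc w s i x < space ?n \<and>
         snd (R, M) (fst (R, M) 0 + table_index A enc w s i x) = lattice_shift w s i x \<and>
         fst (R, M) 1 + table_index A enc w s i x < space ?n \<and>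
         snd (R, M) (fst (R, M) 1 + table_index A enc w s i x) = set_encode (lattice_next w s i x)"
        using at_set_final[of R M, OF _ key] run(3) shift m by simp
    qed
    with run show ?thesis using calculation by blast
  qed
  ultimately show ?thesis
    by (intro exI[of _ "lattice_com a"] exI[of _ time] exI[of _ space] exI[of _ wordlen]) simp
qed

end
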